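(* Let $\mathcal{CA}$ be the set of all Cantor metric spaces in $\mathcal{M}$. Let $(X,d),(Y,e)\in\mathcal{CA}$, and let $A$ be a closed subset of $[0,1]$ with $\{0,1\}\subset A$. Then there exists an $A$-branching bunch of geodesics $F:[0,1]\times\mathbf{Q}\to\mathcal{CA}$ from $(X,d)$ to $(Y,e)$ (that is, an $A$-branching bunch of geodesics in $\mathcal{M}$ all of whose values lie in $\mathcal{CA}$).
   Context: $\mathcal{M}$ is the set of all isometry classes of non-empty compact metric spaces, equipped with the Gromov--Hausdorff distance $d_{GH}$. $\mathbf{Q}=[0,1]^{\mathbb{N}}$ is the Hilbert cube. A Cantor metric space is a metric space homeomorphic to the (middle-third) Cantor set. In a metric space $(S,\rho)$, a geodesic from $x$ to $y$ is a continuous map $\gamma:[0,1]\to S$ with $\gamma(0)=x$, $\gamma(1)=y$ and $\rho(\gamma(s),\gamma(t))=|s-t|\cdot\rho(x,y)$ for all $s,t\in[0,1]$. For a closed $A\subset[0,1]$ with $\{0,1\}\subset A$ and $(X,d),(Y,e)\in\mathcal{M}$, a continuous map $F:[0,1]\times\mathbf{Q}\to\mathcal{M}$ is an $A$-branching bunch of geodesics from $(X,d)$ to $(Y,e)$ if: (1) $F(0,q)=(X,d)$ and $F(1,q)=(Y,e)$ for every $q\in\mathbf{Q}$; (2) $F(s,q)=F(s,r)$ for every $s\in A$ and all $q,r\in\mathbf{Q}$; (3) for each $q\in\mathbf{Q}$ the map $F_q:[0,1]\to\mathcal{M}$, $F_q(s)=F(s,q)$, is a geodesic from $(X,d)$ to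 $(Y,e)$; (4) $F(s,q)\ne F(t,r)$ for all $(s,q),(t,r)\in([0,1]\setminus A)\times\mathbf{Q}$ with $(s,q)\neq(t,r)$.
   Formalization: The formal theorem also assumes that (X,d) and (Y,e) are not isometric or that A = [0,1]; if they are isometric and A is not all of [0,1], every geodesic is constant, so condition (4) fails and no such bunch exists. *)

theory Defs
  imports "HOL-Analysis.Analysis"
begin

section \<open>Isometries and the Hausdorff distance\<close>

definition isometric_embedding :: "'a metric \<Rightarrow> 'b metric \<Rightarrow> ('a \<Rightarrow> 'b) \<Rightarrow> bool" where
  "isometric_embedding X Z f \<longleftrightarrow>
     f ` mspace X \<subseteq> mspace Z \<and>
     (\<forall>x\<in>mspace X. \<forall>y\<in>mspace X. mdist Z (f x) (f y) = mdist X x y)"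

definition isometric :: "'a metric \<Rightarrow> 'b metric \<Rightarrow> bool" where
  "isometric X Y \<longleftrightarrow> (\<exists>f. isometric_embedding X Y f \<and> f ` mspace X = mspace Y)"

definition hausdorff_dist :: "'a metric \<Rightarrow> 'a set \<Rightarrow> 'a set \<Rightarrow> real" where
  "hausdorff_dist Z A B =
     max (SUP a\<in>A. INF b\<in>B. mdist Z a b) (SUP b\<in>B. INF a\<in>A. mdist Z a b)"

text \<open>Nonempty compact metric spaces.\<close>

definition ne_compact :: "'a metric \<Rightarrow> bool" where
  "ne_compact X \<longleftrightarrow> mspace X \<noteq> {} \<and> compact_space (mtopology_of X)"

lemma isometric_embedding_compose:
  assumes "isometric_embedding X Y f" "isometric_embedding Y Z g"
  shows "isometric_embedding X Z (g \<circ> f)"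
  using assms unfolding isometric_embedding_def by (auto simp: image_subset_iff)

lemma isometric_embedding_inj_on:
  assumes "isometric_embedding X Y f"
  shows "inj_on f (mspace X)"
  using assms unfolding isometric_embedding_def inj_on_def image_subset_iff
  by (metis mdist_zero)

lemma isometric_refl: "isometric X X"
  unfolding isometric_def isometric_embedding_def by (rule exI[of _ id]) auto

lemma isometric_sym:
  assumes "isometric X Y"
  shows "isometric Y X"
proof -
  from assms obtain f where f: "isometric_embedding X Y f" "f ` mspace X = mspace Y"
    unfolding isometric_def by blast
  let ?g = "inv_into (mspace X) f"
  have g: "?g y \<in> mspace X" "f (?g y) = y" if "y \<in> mspace Y" for y
    using that f(2) by (metis inv_into_into, metis f_inv_into_f)
  have "isometric_embedding Y X ?g"
    using f(1) g unfolding isometric_embedding_def image_subset_iff by metis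
  moreover have "?g ` mspace Y = mspace X"
    using inv_into_image_cancel[OF isometric_embedding_inj_on[OF f(1)], of "mspace X"] f(2) by simp
  ultimately show ?thesis
    unfolding isometric_def by blast
qed

lemma isometric_trans:
  assumes "isometric X Y" "isometric Y Z"
  shows "isometric X Z"
proof -
  obtain f g where "isometric_embedding X Y f" "f ` mspace X = mspace Y"
    "isometric_embedding Y Z g" "g ` mspace Y = mspace Z"
    using assms unfolding isometric_def by blast
  then have "isometric_embedding X Z (g \<circ> f)" "(g \<circ> f) ` mspace X = mspace Z"
    by (blast intro: isometric_embedding_compose) (metis \<open>f ` mspace X = mspace Y\<close>
      \<open>g ` mspace Y = mspace Z\<close> image_comp)
  then show ?thesis unfolding isometric_def by blast
qed

lemma isometric_imp_homeomorphic_space: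
  assumes "isometric X Y"
  shows "mtopology_of X homeomorphic_space mtopology_of Y"
proof -
  obtain f where f: "isometric_embedding X Y f" "f ` mspace X = mspace Y"
    using assms unfolding isometric_def by blast
  interpret Metric_space12 "mspace X" "mdist X" "mspace Y" "mdist Y"
    by (simp add: Metric_space12_mspace_mdist)
  have "homeomorphic_map (mtopology_of X) (mtopology_of Y) f"
    unfolding mtopology_of_def
    using f by (intro isometry_imp_homeomorphic_map) (auto simp: isometric_embedding_def)
  then show ?thesis
    using homeomorphic_map_imp_homeomorphic_space by blast
qed

section \<open>The Gromov--Hausdorff space\<close>

text \<open>
  Every compact metric space has at most continuum many points, so it is isometric to one whose
  carrier is a subset of the type \<^typ>\<open>real\<close> with some metric unrelated to the usual one (lemma
  \<open>ne_compact_isometric_real\<close>). The type \<open>real metric\<close> therefore represents all isometry classes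
  of compact metric spaces. Likewise, an ambient space of two isometrically embedded compact
  spaces may be cut down to the union of their images, so that ambient spaces carried by
  \<^typ>\<open>real\<close> suffice in the infimum below (lemma \<open>gh_distance_le\<close>).
\<close>

definition gh_distance :: "real metric \<Rightarrow> real metric \<Rightarrow> real" where
  "gh_distance X Y =
     Inf {hausdorff_dist Z (i ` mspace X) (j ` mspace Y) | (Z :: real metric) i j.
            isometric_embedding X Z i \<and> isometric_embedding Y Z j}"

lemma lepoll_isometric_real:
  fixes m :: "'a metric"
  assumes "mspace m \<lesssim> (UNIV :: real set)"
  shows "\<exists>m' :: real metric. isometric m m'"
proof -
  from assms obtain h :: "'a \<Rightarrow> real" where h: "inj_on h (mspace m)"
    unfolding lepoll_def by blast
  let ?g = "inv_into (mspace m) h"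
  let ?d = "\<lambda>x y. mdist m (?g x) (?g y)"
  have gh: "?g (h x) = x" if "x \<in> mspace m" for x
    using h that by simp
  interpret M: Metric_space "h ` mspace m" ?d
  proof
    show "0 \<le> ?d x y" for x y by simp
    show "?d x y = ?d y x" for x y by (rule mdist_commute)
    show "?d x y = 0 \<longleftrightarrow> x = y" if "x \<in> h ` mspace m" "y \<in> h ` mspace m" for x y
      using that gh by auto
    show "?d x z \<le> ?d x y + ?d y z"
      if "x \<in> h ` mspace m" "y \<in> h ` mspace m" "z \<in> h ` mspace m" for x y z
      using that gh by (auto intro: mdist_triangle)
  qed
  have "isometric m (metric (h ` mspace m, ?d))"
    unfolding isometric_def isometric_embedding_def
    by (rule exI[of _ h]) (auto simp: gh)
  then show ?thesis by blast
qed

lemma ne_compact_lepoll_real: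
  fixes m :: "'a metric"
  assumes "ne_compact m"
  shows "mspace m \<lesssim> (UNIV :: real set)"
proof -
  interpret Metric_space "mspace m" "mdist m" by simp
  have "mtotally_bounded (mspace m)"
    using assms compact_space_eq_mcomplete_mtotally_bounded
    by (auto simp: ne_compact_def mtopology_of_def)
  then have "\<exists>K. finite K \<and> K \<subseteq> mspace m \<and> mspace m \<subseteq> (\<Union>x\<in>K. mball x (1 / real (Suc n)))" for n
    unfolding mtotally_bounded_def by (metis of_nat_0_less_iff zero_less_Suc zero_less_divide_1_iff)
  then obtain K where K: "\<And>n. finite (K n)"
    "\<And>n. mspace m \<subseteq> (\<Union>x\<in>K n. mball x (1 / real (Suc n)))"
    by metis
  let ?D = "\<Union>n. K n"
  have D: "countable ?D" using K(1) by (simp add: countable_finite)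
  let ?h = "\<lambda>x. {prod_encode (n, to_nat_on ?D k) | n k. k \<in> K n \<and> x \<in> mball k (1 / real (Suc n))}"
  have "inj_on ?h (mspace m)"
  proof (rule inj_onI, rule ccontr)
    fix x y assume xy: "x \<in> mspace m" "y \<in> mspace m" "?h x = ?h y" "x \<noteq> y"
    then have "0 < mdist m x y / 2" by simp
    then obtain n where n: "1 / real (Suc n) < mdist m x y / 2"
      using nat_approx_posE by blast
    obtain k where k: "k \<in> K n" "x \<in> mball k (1 / real (Suc n))"
      using K(2)[of n] xy(1) by blast
    then have "prod_encode (n, to_nat_on ?D k) \<in> ?h y" unfolding xy(3)[symmetric] by blast
    then obtain k' where k': "k' \<in> K n" "y \<in> mball k' (1 / real (Suc n))"
      "to_nat_on ?D k = to_nat_on ?D k'"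
      by (auto simp: prod_encode_eq)
    then have "k = k'" using D k(1) by (metis UN_I UNIV_I to_nat_on_inj)
    then have "mdist m k x < 1 / real (Suc n)" "mdist m k y < 1 / real (Suc n)" "k \<in> mspace m"
      using k k' by auto
    then show False
      using n xy(1,2) mdist_triangle[of x m k y] mdist_commute[of m x k] by linarith
  qed
  then have "mspace m \<lesssim> (UNIV :: nat set set)"
    unfolding lepoll_def by blast
  then show ?thesis
    using nat_sets_eqpoll_reals lepoll_trans2 by blast
qed

lemma ne_compact_isometric_real:
  fixes m :: "'a metric"
  assumes "ne_compact m"
  shows "\<exists>m' :: real metric. isometric m m'"
  using assms by (intro lepoll_isometric_real ne_compact_lepoll_real)

lemma hausdorff_dist_nonneg:
  assumes "A \<noteq> {}" "B \<noteq> {}" "A \<subseteq> mspace Z" "B \<subseteq> mspace Z"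
    and "Metric_space.mbounded (mspace Z) (mdist Z) A"
    and "Metric_space.mbounded (mspace Z) (mdist Z) B"
  shows "0 \<le> hausdorff_dist Z A B"
proof -
  interpret Metric_space "mspace Z" "mdist Z" by simp
  obtain a where a: "a \<in> A" using assms by blast
  obtain b0 where b0: "b0 \<in> B" using assms by blast
  obtain K where K: "\<And>x y. x \<in> A \<union> B \<Longrightarrow> y \<in> A \<union> B \<Longrightarrow> mdist Z x y \<le> K"
    using assms mbounded_Un mbounded_alt by (metis (no_types, lifting))
  have bd: "bdd_below (mdist Z x ` B)" for x by (rule bdd_belowI[of _ 0]) auto
  have "bdd_above ((\<lambda>a. INF b\<in>B. mdist Z a b) ` A)"
  proof (rule bdd_aboveI2)
    fix x assume "x \<in> A"
    have "(INF b\<in>B. mdist Z x b) \<le> mdist Z x b0" by (rule cINF_lower[OF bd b0])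
    also have "\<dots> \<le> K" using K \<open>x \<in> A\<close> b0 by blast
    finally show "(INF b\<in>B. mdist Z x b) \<le> K" .
  qed
  then have "(INF b\<in>B. mdist Z a b) \<le> (SUP a\<in>A. INF b\<in>B. mdist Z a b)"
    using a by (rule cSUP_upper2) simp
  moreover have "0 \<le> (INF b\<in>B. mdist Z a b)"
    using assms by (intro cINF_greatest) auto
  ultimately show ?thesis unfolding hausdorff_dist_def by linarith
qed

lemma mbounded_isometric_image:
  assumes "ne_compact X" "isometric_embedding X Z i"
  shows "Metric_space.mbounded (mspace Z) (mdist Z) (i ` mspace X)"
proof -
  interpret X: Metric_space "mspace X" "mdist X" by simp
  interpret Z: Metric_space "mspace Z" "mdist Z" by simp
  have "X.mbounded (mspace X)"
    using assms(1) X.compactin_imp_mbounded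
    by (auto simp: ne_compact_def mtopology_of_def compact_space_def)
  then show ?thesis
    using assms(2) unfolding X.mbounded_alt Z.mbounded_alt isometric_embedding_def by auto
qed

lemma gh_distance_le:
  fixes Z :: "'z metric" and X Y :: "real metric"
  assumes X: "ne_compact X" and Y: "ne_compact Y"
    and i: "isometric_embedding X Z i" and j: "isometric_embedding Y Z j"
  shows "gh_distance X Y \<le> hausdorff_dist Z (i ` mspace X) (j ` mspace Y)"
proof -
  let ?U = "i ` mspace X \<union> j ` mspace Y"
  let ?S = "submetric Z ?U"
  have U: "mspace ?S = ?U" "mdist ?S = mdist Z"
    using i j by (auto simp: isometric_embedding_def)
  have fin_un: "P \<union> Q \<lesssim> (UNIV :: real set)"
    if "P \<lesssim> (UNIV :: real set)" "Q \<lesssim> (UNIV :: real set)" for P Q :: "'z set"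
  proof -
    have r: "(UNIV :: real set) \<lesssim> {0<..<1::real}" "(UNIV :: real set) \<lesssim> {2<..<3::real}"
      using open_interval_eqpoll_reals[of 0 1] open_interval_eqpoll_reals[of 2 3]
        eqpoll_imp_lepoll eqpoll_sym by force+
    then have "P \<lesssim> {0<..<1::real}" "Q \<lesssim> {2<..<3::real}"
      using that lepoll_trans by blast+
    moreover have "disjnt {0<..<1::real} {2<..<3}" by (auto simp: disjnt_def)
    ultimately have "P \<union> Q \<lesssim> {0<..<1::real} \<union> {2<..<3}"
      by (rule Un_lepoll_mono)
    then show ?thesis using lepoll_trans subset_imp_lepoll by blast
  qed
  have "mspace ?S \<lesssim> (UNIV :: real set)"
    unfolding U(1)
    by (intro fin_un lepoll_trans[OF image_lepoll subset_imp_lepoll]) auto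
  then obtain R :: "real metric" and f where
    f: "isometric_embedding ?S R f" "f ` mspace ?S = mspace R"
    using lepoll_isometric_real unfolding isometric_def by blast
  have iS: "isometric_embedding X ?S i" "isometric_embedding Y ?S j"
    using i j U by (auto simp: isometric_embedding_def)
  have iR: "isometric_embedding X R (f \<circ> i)" "isometric_embedding Y R (f \<circ> j)"
    using iS f(1) isometric_embedding_compose by blast+
  have fd: "mdist R (f x) (f y) = mdist Z x y" if "x \<in> ?U" "y \<in> ?U" for x y
    using f(1) that U unfolding isometric_embedding_def by auto
  have hd: "hausdorff_dist R ((f \<circ> i) ` mspace X) ((f \<circ> j) ` mspace Y) =
      hausdorff_dist Z (i ` mspace X) (j ` mspace Y)"
    unfolding hausdorff_dist_def image_comp[symmetric] image_image
    by (simp add: fd cong: INF_cong_simp SUP_cong_simp)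
  have "bdd_below {hausdorff_dist Z (i ` mspace X) (j ` mspace Y) | (Z :: real metric) i j.
            isometric_embedding X Z i \<and> isometric_embedding Y Z j}"
    using X Y
    by (intro bdd_belowI[of _ 0])
      (auto intro!: hausdorff_dist_nonneg mbounded_isometric_image
        simp: ne_compact_def isometric_embedding_def)
  then show ?thesis
    unfolding gh_distance_def hd[symmetric] using iR by (intro cInf_lower) blast+
qed

definition gh_rel :: "real metric \<Rightarrow> real metric \<Rightarrow> bool" where
  "gh_rel X Y \<longleftrightarrow> ne_compact X \<and> ne_compact Y \<and> isometric X Y"

lemma ne_compact_singleton: "\<exists>X :: real metric. ne_compact X"
proof -
  have "ne_compact (submetric euclidean_metric {0::real})"
    by (simp add: ne_compact_def mtopology_of_submetric compact_space_subtopology)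
  then show ?thesis by blast
qed

quotient_type gh_space = "real metric" / partial: gh_rel
proof (rule part_equivpI)
  show "\<exists>X. gh_rel X X"
    using ne_compact_singleton isometric_refl unfolding gh_rel_def by blast
  show "symp gh_rel"
    unfolding gh_rel_def symp_def using isometric_sym by blast
  show "transp gh_rel"
    unfolding gh_rel_def transp_def using isometric_trans by blast
qed

lemma gh_distance_isometric_le:
  assumes "isometric X X'" "isometric Y Y'"
  shows "{hausdorff_dist Z (i ` mspace X) (j ` mspace Y) | (Z :: real metric) i j.
            isometric_embedding X Z i \<and> isometric_embedding Y Z j} \<subseteq>
    {hausdorff_dist Z (i ` mspace X') (j ` mspace Y') | (Z :: real metric) i j.
            isometric_embedding X' Z i \<and> isometric_embedding Y' Z j}"
proof -
  obtain f g where f: "isometric_embedding X' X f" "f ` mspace X' = mspace X"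
    and g: "isometric_embedding Y' Y g" "g ` mspace Y' = mspace Y"
    using assms isometric_sym unfolding isometric_def by metis
  show ?thesis
  proof clarify
    fix Z :: "real metric" and i j
    assume "isometric_embedding X Z i" "isometric_embedding Y Z j"
    then have "isometric_embedding X' Z (i \<circ> f)" "isometric_embedding Y' Z (j \<circ> g)"
      using f g isometric_embedding_compose by blast+
    moreover have "(i \<circ> f) ` mspace X' = i ` mspace X" "(j \<circ> g) ` mspace Y' = j ` mspace Y"
      using f g by (simp_all only: image_comp[symmetric])
    ultimately show "\<exists>(Z' :: real metric) i' j'. hausdorff_dist Z (i ` mspace X) (j ` mspace Y) =
        hausdorff_dist Z' (i' ` mspace X') (j' ` mspace Y') \<and>
        isometric_embedding X' Z' i' \<and> isometric_embedding Y' Z' j'"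
      by metis
  qed
qed

lift_definition gh_dist :: "gh_space \<Rightarrow> gh_space \<Rightarrow> real" is gh_distance
  unfolding gh_rel_def gh_distance_def
  by (intro arg_cong[where f = Inf] antisym gh_distance_isometric_le) (auto intro: isometric_sym)

section \<open>Cantor metric spaces\<close>

fun cantor_step :: "nat \<Rightarrow> real set" where
  "cantor_step 0 = {0..1}"
| "cantor_step (Suc n) = (\<lambda>x. x / 3) ` cantor_step n \<union> (\<lambda>x. (x + 2) / 3) ` cantor_step n"

definition cantor_set :: "real set" where
  "cantor_set = (\<Inter>n. cantor_step n)"

definition cantor_metric_space :: "'a metric \<Rightarrow> bool" where
  "cantor_metric_space X \<longleftrightarrow> mtopology_of X homeomorphic_space top_of_set cantor_set"

lift_definition cantor_class :: "gh_space \<Rightarrow> bool" is cantor_metric_space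
  unfolding gh_rel_def cantor_metric_space_def
  by (meson homeomorphic_space_sym homeomorphic_space_trans isometric_imp_homeomorphic_space)

definition CA :: "gh_space set" where
  "CA = {X. cantor_class X}"

section \<open>Branching bunches of geodesics\<close>

definition geodesic :: "'s set \<Rightarrow> ('s \<Rightarrow> 's \<Rightarrow> real) \<Rightarrow> (real \<Rightarrow> 's) \<Rightarrow> 's \<Rightarrow> 's \<Rightarrow> bool" where
  "geodesic S \<rho> \<gamma> x y \<longleftrightarrow>
     continuous_map (top_of_set {0..1}) (Metric_space.mtopology S \<rho>) \<gamma> \<and>
     \<gamma> 0 = x \<and> \<gamma> 1 = y \<and>
     (\<forall>s\<in>{0..1}. \<forall>t\<in>{0..1}. \<rho> (\<gamma> s) (\<gamma> t) = \<bar>s - t\<bar> * \<rho> x y)"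

definition hilbert_cube :: "(nat \<Rightarrow> real) topology" where
  "hilbert_cube = product_topology (\<lambda>_. top_of_set {0..1}) UNIV"

text \<open>
  Only the values of \<open>F\<close> on \<open>[0,1]\<close> times the Hilbert cube are constrained.
  If \<open>X = Y\<close>, every geodesic from \<open>X\<close> to \<open>Y\<close> is constant, so the last clause can
  hold only if \<open>A = {0..1}\<close>.
\<close>

definition branching_bunch ::
  "real set \<Rightarrow> gh_space \<Rightarrow> gh_space \<Rightarrow> (real \<times> (nat \<Rightarrow> real) \<Rightarrow> gh_space) \<Rightarrow> bool" where
  "branching_bunch A X Y F \<longleftrightarrow>
     continuous_map (prod_topology (top_of_set {0..1}) hilbert_cube)
       (Metric_space.mtopology UNIV gh_dist) F \<and>
     (\<forall>q\<in>topspace hilbert_cube. F (0, q) = X \<and> F (1, q) = Y) \<and>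
     (\<forall>s\<in>A. \<forall>q\<in>topspace hilbert_cube. \<forall>r\<in>topspace hilbert_cube. F (s, q) = F (s, r)) \<and>
     (\<forall>q\<in>topspace hilbert_cube. geodesic UNIV gh_dist (\<lambda>s. F (s, q)) X Y) \<and>
     (\<forall>(s, q) \<in> ({0..1} - A) \<times> topspace hilbert_cube.
        \<forall>(t, r) \<in> ({0..1} - A) \<times> topspace hilbert_cube.
          (s, q) \<noteq> (t, r) \<longrightarrow> F (s, q) \<noteq> F (t, r))"

end

theory Submission
  imports Defs
begin

text \<open>
  Let \<open>D\<close> be the Gromov--Hausdorff distance of two Cantor metric spaces \<open>(X, d)\<close> and \<open>(Y, e)\<close>. By
  compactness it is attained by a closed correspondence of distortion at most \<open>2 D\<close>, which is the
  image of the Cantor space \<open>K = {0,1}\<^sup>\<nat>\<close> under a continuous map \<open>(f, g)\<close>. On \<open>K\<close> consider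
  \<open>\<rho>\<^sub>s\<^sub>,\<^sub>q = max ((1 - s) f\<^sup>*d + s g\<^sup>*e) u\<^sub>s\<^sub>,\<^sub>q\<close>, where \<open>u\<^sub>s\<^sub>,\<^sub>q\<close> is an ultrametric inducing the topology of
  \<open>K\<close>. Both terms are \<open>2 D\<close>-Lipschitz in \<open>s\<close>, hence so is the maximum, and by the triangle inequality
  the classes of \<open>(K, \<rho>\<^sub>s\<^sub>,\<^sub>q)\<close> form a geodesic from \<open>X\<close> to \<open>Y\<close>.

  The ultrametric encodes \<open>q\<close> with amplitude proportional to the distance from \<open>s\<close> to \<open>A\<close>. Its value
  \<open>w\<^sub>k\<close> at points that first differ in place \<open>k\<close> tends to \<open>0\<close> so slowly that for large \<open>k\<close> it
  dominates the diameters, in the interpolated metric, of the \<open>2\<^sup>k\<close> cylinders of length \<open>k\<close>. By the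
  pigeonhole principle \<open>w\<^sub>k\<close> is then the largest possible separation of \<open>2\<^sup>k\<^sup>+\<^sup>1\<close> points of
  \<open>(K, \<rho>\<^sub>s\<^sub>,\<^sub>q)\<close>, an isometry invariant from which \<open>q\<close> can be read off when \<open>s \<notin> A\<close>.
\<close>

section \<open>Correspondences and couplings\<close>

text \<open>The inequalities are those that a cross distance \<open>c\<close> must satisfy to extend
  the two metrics to a pseudometric on the disjoint union. The value 0 is allowed and every
  inequality is weak, so the condition survives pointwise limits.\<close>

definition coupling :: "'a metric \<Rightarrow> 'b metric \<Rightarrow> ('a \<Rightarrow> 'b \<Rightarrow> real) \<Rightarrow> bool" where
  "coupling X Y c \<longleftrightarrow>
     (\<forall>x\<in>mspace X. \<forall>y\<in>mspace Y. 0 \<le> c x y) \<and>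
     (\<forall>x\<in>mspace X. \<forall>x'\<in>mspace X. \<forall>y\<in>mspace Y.
        c x y \<le> mdist X x x' + c x' y \<and> mdist X x x' \<le> c x y + c x' y) \<and>
     (\<forall>x\<in>mspace X. \<forall>y\<in>mspace Y. \<forall>y'\<in>mspace Y.
        c x y \<le> c x y' + mdist Y y' y \<and> mdist Y y y' \<le> c x y + c x y')"

definition correspondence :: "'a metric \<Rightarrow> 'b metric \<Rightarrow> ('a \<times> 'b) set \<Rightarrow> bool" where
  "correspondence X Y R \<longleftrightarrow>
     R \<subseteq> mspace X \<times> mspace Y \<and> fst ` R = mspace X \<and> snd ` R = mspace Y"

text \<open>The factor 2 reflects that the Gromov-Hausdorff distance is half the least distortion of
  a correspondence. The carriers may have different types, which admits spaces of binary
  sequences.\<close>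

definition gh_close :: "'a metric \<Rightarrow> 'b metric \<Rightarrow> real \<Rightarrow> bool" where
  "gh_close X Y r \<longleftrightarrow>
     (\<exists>R. correspondence X Y R \<and>
        (\<forall>(x, y)\<in>R. \<forall>(x', y')\<in>R. \<bar>mdist X x x' - mdist Y y y'\<bar> \<le> 2 * r))"

lemma correspondence_left:
  assumes "correspondence X Y R" "x \<in> mspace X"
  shows "\<exists>y. (x, y) \<in> R"
proof -
  have "x \<in> fst ` R"
    using assms by (simp add: correspondence_def)
  then show ?thesis by auto
qed

lemma correspondence_right:
  assumes "correspondence X Y R" "y \<in> mspace Y"
  shows "\<exists>x. (x, y) \<in> R"
proof -
  have "y \<in> snd ` R"
    using assms by (simp add: correspondence_def)
  then show ?thesis by auto
qed

lemma gh_closeI: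
  assumes "\<And>z. z \<in> S \<Longrightarrow> f z \<in> mspace X" "\<And>z. z \<in> S \<Longrightarrow> g z \<in> mspace Y"
    and "\<And>x. x \<in> mspace X \<Longrightarrow> \<exists>z\<in>S. f z = x" "\<And>y. y \<in> mspace Y \<Longrightarrow> \<exists>z\<in>S. g z = y"
    and "\<And>z z'. z \<in> S \<Longrightarrow> z' \<in> S \<Longrightarrow> \<bar>mdist X (f z) (f z') - mdist Y (g z) (g z')\<bar> \<le> 2 * r"
  shows "gh_close X Y r"
  unfolding gh_close_def
proof (intro exI conjI)
  show "correspondence X Y ((\<lambda>z. (f z, g z)) ` S)"
    using assms(1-4) unfolding correspondence_def image_image by (auto simp: image_iff) metis+
  show "\<forall>(x, y)\<in>(\<lambda>z. (f z, g z)) ` S. \<forall>(x', y')\<in>(\<lambda>z. (f z, g z)) ` S.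
      \<bar>mdist X x x' - mdist Y y y'\<bar> \<le> 2 * r"
    by (simp add: assms(5))
qed

text \<open>Distortions add along the composite correspondence; parametrising it by triples keeps
  the intermediate point at hand.\<close>

lemma gh_close_trans:
  assumes "gh_close X Y r" "gh_close Y Z s"
  shows "gh_close X Z (r + s)"
proof -
  obtain R S where R: "correspondence X Y R"
      "\<And>x y x' y'. (x, y) \<in> R \<Longrightarrow> (x', y') \<in> R \<Longrightarrow> \<bar>mdist X x x' - mdist Y y y'\<bar> \<le> 2 * r"
    and S: "correspondence Y Z S"
      "\<And>x y x' y'. (x, y) \<in> S \<Longrightarrow> (x', y') \<in> S \<Longrightarrow> \<bar>mdist Y x x' - mdist Z y y'\<bar> \<le> 2 * s"
    using assms unfolding gh_close_def by fast
  have R1: "\<exists>y. (x, y) \<in> R" if "x \<in> mspace X" for x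
    using correspondence_left[OF R(1) that] .
  have R2: "\<exists>x. (x, y) \<in> R" if "y \<in> mspace Y" for y
    using correspondence_right[OF R(1) that] .
  have S1: "\<exists>z. (y, z) \<in> S" if "y \<in> mspace Y" for y
    using correspondence_left[OF S(1) that] .
  have S2: "\<exists>y. (y, z) \<in> S" if "z \<in> mspace Z" for z
    using correspondence_right[OF S(1) that] .
  have sub: "R \<subseteq> mspace X \<times> mspace Y" "S \<subseteq> mspace Y \<times> mspace Z"
    using R(1) S(1) by (auto simp: correspondence_def)
  show ?thesis
  proof (rule gh_closeI[where S = "{(x, y, z). (x, y) \<in> R \<and> (y, z) \<in> S}" and f = fst
        and g = "\<lambda>p. snd (snd p)"])
    show "\<exists>p\<in>{(x, y, z). (x, y) \<in> R \<and> (y, z) \<in> S}. fst p = x" if "x \<in> mspace X" for x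
      using R1[OF that] S1 sub by (fastforce)
    show "\<exists>p\<in>{(x, y, z). (x, y) \<in> R \<and> (y, z) \<in> S}. snd (snd p) = z" if "z \<in> mspace Z" for z
      using S2[OF that] R2 sub by (fastforce)
  next
    fix p p' assume "p \<in> {(x, y, z). (x, y) \<in> R \<and> (y, z) \<in> S}"
      "p' \<in> {(x, y, z). (x, y) \<in> R \<and> (y, z) \<in> S}"
    then show "\<bar>mdist X (fst p) (fst p') - mdist Z (snd (snd p)) (snd (snd p'))\<bar> \<le> 2 * (r + s)"
      using R(2)[of "fst p" "fst (snd p)" "fst p'" "fst (snd p')"]
        S(2)[of "fst (snd p)" "snd (snd p)" "fst (snd p')" "snd (snd p')"]
      by (auto simp: split_beta)
  qed (use sub in auto)
qed

lemma gh_close_sym: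
  assumes "gh_close X Y r" shows "gh_close Y X r"
proof -
  obtain R where R: "correspondence X Y R"
      "\<And>x y x' y'. (x, y) \<in> R \<Longrightarrow> (x', y') \<in> R \<Longrightarrow> \<bar>mdist X x x' - mdist Y y y'\<bar> \<le> 2 * r"
    using assms unfolding gh_close_def by fast
  show ?thesis
  proof (rule gh_closeI[where S = R and f = snd and g = fst])
    show "\<exists>z\<in>R. snd z = x" if "x \<in> mspace Y" for x
      using R(1) that unfolding correspondence_def by (metis imageE)
    show "\<exists>z\<in>R. fst z = x" if "x \<in> mspace X" for x
      using R(1) that unfolding correspondence_def by (metis imageE)
    show "\<bar>mdist Y (snd z) (snd z') - mdist X (fst z) (fst z')\<bar> \<le> 2 * r" if "z \<in> R" "z' \<in> R" for z z'
      using R(2)[of "fst z" "snd z" "fst z'" "snd z'"] that by auto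
  qed (use R(1) in \<open>auto simp: correspondence_def\<close>)
qed

lemma isometric_imp_gh_close:
  assumes "isometric X Y"
  shows "gh_close X Y 0"
proof -
  obtain f where f: "isometric_embedding X Y f" "f ` mspace X = mspace Y"
    using assms unfolding isometric_def by blast
  show ?thesis
  proof (rule gh_closeI[where S = "mspace X" and f = id and g = f])
    show "\<exists>z\<in>mspace X. f z = y" if "y \<in> mspace Y" for y
      using that unfolding f(2)[symmetric] by blast
  qed (use f in \<open>auto simp: isometric_embedding_def\<close>)
qed

text \<open>Cross distances are shortest routes that use one pair of the correspondence as a bridge
  of length \<open>r\<close>. A detour over two bridges costs \<open>2 * r\<close>, which offsets
  the distortion, so neither metric is shortened; the bridge length also makes the coupling strictly
  positive.\<close>

lemma gh_close_imp_coupling: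
  assumes "gh_close X Y r" "0 < r" and ne: "mspace X \<noteq> {}"
  obtains c where "coupling X Y c" "\<And>x y. x \<in> mspace X \<Longrightarrow> y \<in> mspace Y \<Longrightarrow> 0 < c x y"
    "\<And>x. x \<in> mspace X \<Longrightarrow> \<exists>y\<in>mspace Y. c x y \<le> r"
    "\<And>y. y \<in> mspace Y \<Longrightarrow> \<exists>x\<in>mspace X. c x y \<le> r"
proof -
  obtain R where R: "correspondence X Y R"
      "\<And>x y x' y'. (x, y) \<in> R \<Longrightarrow> (x', y') \<in> R \<Longrightarrow> \<bar>mdist X x x' - mdist Y y y'\<bar> \<le> 2 * r"
    using assms unfolding gh_close_def by fast
  have Rne: "R \<noteq> {}" using R(1) ne by (auto simp: correspondence_def)
  have sub: "x \<in> mspace X" "y \<in> mspace Y" if "(x, y) \<in> R" for x y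
    using R(1) that by (auto simp: correspondence_def)
  define v where "v x y p = mdist X x (fst p) + mdist Y (snd p) y + r" for x y p
  define c where "c x y = (INF p\<in>R. v x y p)" for x y
  have low: "c x y \<le> v x y p" if "p \<in> R" for x y p
    unfolding c_def by (rule cINF_lower[OF _ that]) (rule bdd_belowI[of _ r], auto simp: v_def)
  have great: "t \<le> c x y" if "\<And>p. p \<in> R \<Longrightarrow> t \<le> v x y p" for t x y
    unfolding c_def using that by (rule cINF_greatest[OF Rne])
  have vsub: "fst p \<in> mspace X" "snd p \<in> mspace Y" if "p \<in> R" for p
    using that sub by (metis prod.collapse)+
  have dis: "\<bar>mdist X (fst p) (fst p') - mdist Y (snd p) (snd p')\<bar> \<le> 2 * r" if "p \<in> R" "p' \<in> R" for p p'
    using R(2) that by (metis prod.collapse)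
  have z: "mdist X x x = 0" if "x \<in> mspace X" for x using that by simp
  have z': "mdist Y y y = 0" if "y \<in> mspace Y" for y using that by simp
  have sum: "t \<le> c x y + c x' y'" if "\<And>p p'. p \<in> R \<Longrightarrow> p' \<in> R \<Longrightarrow> t \<le> v x y p + v x' y' p'" for t x y x' y'
  proof -
    have "t - v x' y' p' \<le> c x y" if "p' \<in> R" for p'
      using \<open>\<And>p p'. p \<in> R \<Longrightarrow> p' \<in> R \<Longrightarrow> t \<le> v x y p + v x' y' p'\<close>[OF _ that]
      by (intro great) (smt (verit, best))
    then have "t - c x y \<le> c x' y'"
      by (intro great) (smt (verit, best))
    then show ?thesis by simp
  qed
  have pos: "r \<le> c x y" for x y
    by (rule great) (simp add: v_def)
  show ?thesis
  proof
    show "coupling X Y c"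
      unfolding coupling_def
    proof (intro conjI ballI)
      show "0 \<le> c x y" for x y using pos[of x y] \<open>0 < r\<close> by linarith
      show "c x y \<le> mdist X x x' + c x' y" if "x \<in> mspace X" "x' \<in> mspace X" for x x' y
      proof -
        have "c x y - mdist X x x' \<le> v x' y p" if "p \<in> R" for p
          using low[OF that, of x y] mdist_triangle[of x X x' "fst p"] vsub[OF that]
            \<open>x \<in> mspace X\<close> \<open>x' \<in> mspace X\<close> by (simp add: v_def)
        then have "c x y - mdist X x x' \<le> c x' y" by (rule great)
        then show ?thesis by simp
      qed
      show "c x y \<le> c x y' + mdist Y y' y" if "y \<in> mspace Y" "y' \<in> mspace Y" for x y y'
      proof -
        have "c x y - mdist Y y' y \<le> v x y' p" if "p \<in> R" for p
          using low[OF that, of x y] mdist_triangle[of "snd p" Y y' y] vsub[OF that]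
            \<open>y \<in> mspace Y\<close> \<open>y' \<in> mspace Y\<close> by (simp add: v_def)
        then have "c x y - mdist Y y' y \<le> c x y'" by (rule great)
        then show ?thesis by simp
      qed
      show "mdist X x x' \<le> c x y + c x' y" if "x \<in> mspace X" "x' \<in> mspace X" "y \<in> mspace Y" for x x' y
      proof (rule sum)
        fix p p' assume p: "p \<in> R" "p' \<in> R"
        show "mdist X x x' \<le> v x y p + v x' y p'"
          using dis[OF p] vsub[OF p(1)] vsub[OF p(2)] that
            mdist_triangle[of x X "fst p" x'] mdist_triangle[of "fst p" X "fst p'" x']
            mdist_triangle[of "snd p" Y y "snd p'"] mdist_commute[of Y y "snd p'"]
            mdist_commute[of X x' "fst p'"]
          by (simp add: v_def)
      qed
      show "mdist Y y y' \<le> c x y + c x y'" if "x \<in> mspace X" "y \<in> mspace Y" "y' \<in> mspace Y" for x y y'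
      proof (rule sum)
        fix p p' assume p: "p \<in> R" "p' \<in> R"
        show "mdist Y y y' \<le> v x y p + v x y' p'"
          using dis[OF p] vsub[OF p(1)] vsub[OF p(2)] that
            mdist_triangle[of y Y "snd p" y'] mdist_triangle[of "snd p" Y "snd p'" y']
            mdist_triangle[of "fst p" X x "fst p'"] mdist_commute[of Y y "snd p"]
            mdist_commute[of X x "fst p"]
          by (simp add: v_def)
      qed
    qed
    show "0 < c x y" for x y using pos[of x y] \<open>0 < r\<close> by linarith
    show "\<exists>y\<in>mspace Y. c x y \<le> r" if "x \<in> mspace X" for x
    proof -
      obtain y where xy: "(x, y) \<in> R"
        using correspondence_left[OF R(1)] \<open>x \<in> mspace X\<close> by blast
      show ?thesis using low[OF xy, of x y] sub[OF xy] z z' by (intro bexI) (auto simp: v_def)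
    qed
    show "\<exists>x\<in>mspace X. c x y \<le> r" if "y \<in> mspace Y" for y
    proof -
      obtain x where xy: "(x, y) \<in> R"
        using correspondence_right[OF R(1)] \<open>y \<in> mspace Y\<close> by blast
      show ?thesis using low[OF xy, of x y] sub[OF xy] z z' by (intro bexI) (auto simp: v_def)
    qed
  qed
qed

lemma coupling_imp_gh_close:
  assumes "coupling X Y c"
    and "\<And>x. x \<in> mspace X \<Longrightarrow> \<exists>y\<in>mspace Y. c x y \<le> r"
    and "\<And>y. y \<in> mspace Y \<Longrightarrow> \<exists>x\<in>mspace X. c x y \<le> r"
  shows "gh_close X Y r"
proof (rule gh_closeI[where S = "{(x, y) \<in> mspace X \<times> mspace Y. c x y \<le> r}" and f = fst and g = snd])
  fix z z' assume "z \<in> {(x, y) \<in> mspace X \<times> mspace Y. c x y \<le> r}"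
    "z' \<in> {(x, y) \<in> mspace X \<times> mspace Y. c x y \<le> r}"
  then obtain x y x' y' where z: "z = (x, y)" "z' = (x', y')" "x \<in> mspace X" "x' \<in> mspace X"
    "y \<in> mspace Y" "y' \<in> mspace Y" "c x y \<le> r" "c x' y' \<le> r"
    by auto
  have "mdist X x x' \<le> c x y + c x' y" "c x' y \<le> c x' y' + mdist Y y' y"
    "mdist Y y y' \<le> c x y + c x y'" "c x y' \<le> mdist X x x' + c x' y'"
    using assms(1) z(3-6) unfolding coupling_def by blast+
  then show "\<bar>mdist X (fst z) (fst z') - mdist Y (snd z) (snd z')\<bar> \<le> 2 * r"
    using z(7,8) mdist_commute[of Y y y'] by (simp add: z(1,2))
next
  show "\<exists>z\<in>{(x, y) \<in> mspace X \<times> mspace Y. c x y \<le> r}. fst z = x" if "x \<in> mspace X" for x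
    using assms(2)[OF that] that by auto
  show "\<exists>z\<in>{(x, y) \<in> mspace X \<times> mspace Y. c x y \<le> r}. snd z = y" if "y \<in> mspace Y" for y
    using assms(3)[OF that] that by auto
qed auto

section \<open>Realising couplings in a common metric space\<close>

lemma real_sum_lepoll_real: "(A :: (real + real) set) \<lesssim> (UNIV :: real set)"
  unfolding lepoll_def
proof (intro exI conjI)
  \<comment> \<open>The summands are sent into the positive and the negative half-line.\<close>
  show "inj_on (case_sum exp (\<lambda>x. - exp x)) A"
  proof (rule inj_onI)
    fix x y :: "real + real"
    assume eq: "case_sum exp (\<lambda>x. - exp x) x = case_sum exp (\<lambda>x. - exp x) y"
    have "exp a \<noteq> - exp b" for a b :: real
      using exp_gt_zero[of a] exp_gt_zero[of b] by linarith
    then show "x = y"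
      using eq by (cases x; cases y) (simp_all, metis)
  qed
qed simp

lemma coupling_imp_common_space:
  fixes X Y :: "real metric"
  assumes c: "coupling X Y c" and pos: "\<And>x y. x \<in> mspace X \<Longrightarrow> y \<in> mspace Y \<Longrightarrow> 0 < c x y"
  obtains Z :: "real metric" and i j where "isometric_embedding X Z i" "isometric_embedding Y Z j"
    "\<And>x y. x \<in> mspace X \<Longrightarrow> y \<in> mspace Y \<Longrightarrow> mdist Z (i x) (j y) = c x y"
proof -
  define d where "d u v = (case (u, v) of
    (Inl x, Inl x') \<Rightarrow> mdist X x x' | (Inl x, Inr y) \<Rightarrow> c x y |
    (Inr y, Inl x) \<Rightarrow> c x y | (Inr y, Inr y') \<Rightarrow> mdist Y y y')" for u v
  let ?M = "mspace X <+> mspace Y"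
  \<comment> \<open>\<open>Metric_space\<close> demands nonnegativity at all arguments, whereas
    \<open>c\<close> is controlled on the carriers only; hence the default value 0.\<close>
  let ?d = "\<lambda>u v. if u \<in> ?M \<and> v \<in> ?M then d u v else 0"
  have cc: "c x y \<le> mdist X x x' + c x' y" "mdist X x x' \<le> c x y + c x' y"
    if "x \<in> mspace X" "x' \<in> mspace X" "y \<in> mspace Y" for x x' y
    using c that unfolding coupling_def by blast+
  have cc': "c x y \<le> c x y' + mdist Y y' y" "mdist Y y y' \<le> c x y + c x y'"
    if "x \<in> mspace X" "y \<in> mspace Y" "y' \<in> mspace Y" for x y y'
    using c that unfolding coupling_def by blast+
  have cc_comm: "c x' y \<le> c x y + mdist X x x'" "c x y \<le> mdist Y y y' + c x y'"
    if "x \<in> mspace X" "x' \<in> mspace X" "y \<in> mspace Y" "y' \<in> mspace Y" for x x' y y'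
    using cc(1)[of x' x y] cc'(1)[of x y y'] that by (simp_all add: mdist_commute add.commute)
  have cne: "c x y \<noteq> 0" if "x \<in> mspace X" "y \<in> mspace Y" for x y
    using pos[OF that] by simp
  interpret M: Metric_space ?M ?d
  proof
    show "0 \<le> ?d u v" for u v
      using pos by (auto simp: d_def less_imp_le)
    show "?d u v = ?d v u" for u v
      by (auto simp: d_def mdist_commute split: sum.splits)
    show "?d u v = 0 \<longleftrightarrow> u = v" if "u \<in> ?M" "v \<in> ?M" for u v
      using that by (auto simp: d_def cne)
    show "?d u w \<le> ?d u v + ?d v w" if "u \<in> ?M" "v \<in> ?M" "w \<in> ?M" for u v w
    proof -
      have "d u w \<le> d u v + d v w"
        using that by (auto simp: d_def intro: mdist_triangle cc cc' cc_comm)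
      then show ?thesis using that by simp
    qed
  qed
  obtain Z :: "real metric" where "isometric (metric (?M, ?d)) Z"
    using lepoll_isometric_real[of "metric (?M, ?d)"] real_sum_lepoll_real by auto
  then obtain f where f: "isometric_embedding (metric (?M, ?d)) Z f"
    unfolding isometric_def by blast
  have l: "isometric_embedding X (metric (?M, ?d)) Inl" "isometric_embedding Y (metric (?M, ?d)) Inr"
    unfolding isometric_embedding_def by (auto simp: d_def)
  show ?thesis
  proof
    show "isometric_embedding X Z (f \<circ> Inl)" "isometric_embedding Y Z (f \<circ> Inr)"
      using l f isometric_embedding_compose by blast+
    show "mdist Z ((f \<circ> Inl) x) ((f \<circ> Inr) y) = c x y" if "x \<in> mspace X" "y \<in> mspace Y" for x y
    proof -
      have "mdist Z (f (Inl x)) (f (Inr y)) = ?d (Inl x) (Inr y)"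
        using f that unfolding isometric_embedding_def M.mdist_metric M.mspace_metric by blast
      then show ?thesis using that by (simp add: d_def InlI InrI)
    qed
  qed
qed

lemma hausdorff_dist_le:
  assumes "A \<noteq> {}" "B \<noteq> {}"
    and "\<And>a. a \<in> A \<Longrightarrow> \<exists>b\<in>B. mdist Z a b \<le> r" "\<And>b. b \<in> B \<Longrightarrow> \<exists>a\<in>A. mdist Z a b \<le> r"
  shows "hausdorff_dist Z A B \<le> r"
proof -
  have "(INF b\<in>B. mdist Z a b) \<le> r" if "a \<in> A" for a
    using assms(3)[OF that] by (meson bdd_belowI2 cINF_lower2 mdist_nonneg)
  moreover have "(INF a\<in>A. mdist Z a b) \<le> r" if "b \<in> B" for b
    using assms(4)[OF that] by (meson bdd_belowI2 cINF_lower2 mdist_nonneg)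
  ultimately show ?thesis
    unfolding hausdorff_dist_def using assms(1,2) by (simp add: cSUP_least)
qed

lemma gh_close_imp_gh_distance_le:
  fixes X Y :: "real metric"
  assumes "ne_compact X" "ne_compact Y" "gh_close X Y r" "0 < r"
  shows "gh_distance X Y \<le> r"
proof -
  have ne: "mspace X \<noteq> {}" "mspace Y \<noteq> {}" using assms by (auto simp: ne_compact_def)
  obtain c where c: "coupling X Y c" "\<And>x y. x \<in> mspace X \<Longrightarrow> y \<in> mspace Y \<Longrightarrow> 0 < c x y"
    "\<And>x. x \<in> mspace X \<Longrightarrow> \<exists>y\<in>mspace Y. c x y \<le> r"
    "\<And>y. y \<in> mspace Y \<Longrightarrow> \<exists>x\<in>mspace X. c x y \<le> r"
    using gh_close_imp_coupling[OF assms(3,4) ne(1)] by blast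
  obtain Z :: "real metric" and i j where
    Z: "isometric_embedding X Z i" "isometric_embedding Y Z j"
    "\<And>x y. x \<in> mspace X \<Longrightarrow> y \<in> mspace Y \<Longrightarrow> mdist Z (i x) (j y) = c x y"
    using coupling_imp_common_space[OF c(1,2)] by blast
  have "hausdorff_dist Z (i ` mspace X) (j ` mspace Y) \<le> r"
    using ne c(3,4) Z(3) by (intro hausdorff_dist_le) auto
  then show ?thesis
    using gh_distance_le[OF assms(1,2) Z(1,2)] by linarith
qed

lemma mdist_le_of_ne_compact:
  assumes "ne_compact X"
  obtains K where "\<And>x y. x \<in> mspace X \<Longrightarrow> y \<in> mspace X \<Longrightarrow> mdist X x y \<le> K"
proof -
  interpret Metric_space "mspace X" "mdist X" by simp
  have "mbounded (mspace X)"
    using assms compactin_imp_mbounded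
    by (auto simp: ne_compact_def mtopology_of_def compact_space_def)
  then show ?thesis using that unfolding mbounded_alt by blast
qed

text \<open>The full product is a correspondence whose distortion is bounded by the diameters. It
  serves to show that the infimum defining \<open>gh_distance\<close> is over a nonempty
  set.\<close>

lemma ne_compact_gh_close:
  assumes "ne_compact X" "ne_compact Y"
  obtains r where "gh_close X Y r" "0 < r"
proof -
  obtain K L where K: "\<And>x y. x \<in> mspace X \<Longrightarrow> y \<in> mspace X \<Longrightarrow> mdist X x y \<le> K"
    and L: "\<And>x y. x \<in> mspace Y \<Longrightarrow> y \<in> mspace Y \<Longrightarrow> mdist Y x y \<le> L"
    using assms mdist_le_of_ne_compact by metis
  have "gh_close X Y (\<bar>K\<bar> + \<bar>L\<bar> + 1)"
  proof (rule gh_closeI[where S = "mspace X \<times> mspace Y" and f = fst and g = snd])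
    fix z z' assume z: "z \<in> mspace X \<times> mspace Y" "z' \<in> mspace X \<times> mspace Y"
    then have "mdist X (fst z) (fst z') \<le> K" "mdist Y (snd z) (snd z') \<le> L"
      using K L by auto
    moreover have "0 \<le> mdist X (fst z) (fst z')" "0 \<le> mdist Y (snd z) (snd z')"
      by auto
    ultimately show "\<bar>mdist X (fst z) (fst z') - mdist Y (snd z) (snd z')\<bar> \<le> 2 * (\<bar>K\<bar> + \<bar>L\<bar> + 1)"
      by argo
  qed (use assms in \<open>auto simp: ne_compact_def\<close>)
  then show ?thesis using that by (metis abs_ge_zero add_nonneg_nonneg add_nonneg_pos zero_less_one)
qed

text \<open>An ambient space with Hausdorff distance below \<open>r\<close> exists because the
  infimum lies below \<open>r\<close>, and its metric restricted to cross pairs is the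
  coupling.\<close>

lemma gh_distance_less_imp_coupling:
  fixes X Y :: "real metric"
  assumes X: "ne_compact X" and Y: "ne_compact Y" and r: "gh_distance X Y < r"
  obtains c where "coupling X Y c"
    "\<And>x. x \<in> mspace X \<Longrightarrow> \<exists>y\<in>mspace Y. c x y \<le> r"
    "\<And>y. y \<in> mspace Y \<Longrightarrow> \<exists>x\<in>mspace X. c x y \<le> r"
proof -
  have ne: "mspace X \<noteq> {}" "mspace Y \<noteq> {}" using X Y by (auto simp: ne_compact_def)
  obtain r0 where "gh_close X Y r0" "0 < r0" using ne_compact_gh_close[OF X Y] by blast
  then obtain c0 where "coupling X Y c0" "\<And>x y. x \<in> mspace X \<Longrightarrow> y \<in> mspace Y \<Longrightarrow> 0 < c0 x y"
    using gh_close_imp_coupling ne(1) by metis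
  then obtain Z0 :: "real metric" and i0 j0 where
    "isometric_embedding X Z0 i0" "isometric_embedding Y Z0 j0"
    using coupling_imp_common_space by metis
  then have "{hausdorff_dist Z (i ` mspace X) (j ` mspace Y) | (Z :: real metric) i j.
            isometric_embedding X Z i \<and> isometric_embedding Y Z j} \<noteq> {}"
    by blast
  from cInf_lessD[OF this r[unfolded gh_distance_def]]
  obtain Z :: "real metric" and i j where
    Z: "isometric_embedding X Z i" "isometric_embedding Y Z j"
      and h: "hausdorff_dist Z (i ` mspace X) (j ` mspace Y) < r"
    by blast
  interpret Z: Metric_space "mspace Z" "mdist Z" by simp
  have in_Z: "i x \<in> mspace Z" if "x \<in> mspace X" for x
    using Z(1) that by (auto simp: isometric_embedding_def)
  have jn_Z: "j x \<in> mspace Z" if "x \<in> mspace Y" for x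
    using Z(2) that by (auto simp: isometric_embedding_def)
  have iZ: "mdist Z (i x) (i x') = mdist X x x'" if "x \<in> mspace X" "x' \<in> mspace X" for x x'
    using Z(1) that by (auto simp: isometric_embedding_def)
  have jZ: "mdist Z (j x) (j x') = mdist Y x x'" if "x \<in> mspace Y" "x' \<in> mspace Y" for x x'
    using Z(2) that by (auto simp: isometric_embedding_def)
  have "Z.mbounded (i ` mspace X \<union> j ` mspace Y)"
    using mbounded_isometric_image[OF X Z(1)] mbounded_isometric_image[OF Y Z(2)] Z.mbounded_Un
    by blast
  then obtain K where "\<forall>u\<in>i ` mspace X \<union> j ` mspace Y. \<forall>v\<in>i ` mspace X \<union> j ` mspace Y. mdist Z u v \<le> K"
    unfolding Z.mbounded_alt by blast
  then have K: "mdist Z (i x) (j y) \<le> K" if "x \<in> mspace X" "y \<in> mspace Y" for x y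
    using that by blast
  have bd: "bdd_below (f ` S)" if "\<And>u. 0 \<le> f u" for f :: "real \<Rightarrow> real" and S
    using that by (intro bdd_belowI[of _ 0]) auto
  show ?thesis
  proof
    show "coupling X Y (\<lambda>x y. mdist Z (i x) (j y))"
      unfolding coupling_def
    proof (intro conjI ballI)
      fix x x' y assume "x \<in> mspace X" "x' \<in> mspace X" "y \<in> mspace Y"
      then show "mdist Z (i x) (j y) \<le> mdist X x x' + mdist Z (i x') (j y)"
        "mdist X x x' \<le> mdist Z (i x) (j y) + mdist Z (i x') (j y)"
        using Z.triangle[of "i x" "i x'" "j y"] Z.triangle[of "i x" "j y" "i x'"]
          Z.commute[of "j y" "i x'"]
        by (simp_all add: iZ in_Z jn_Z)
    next
      fix x y y' assume "x \<in> mspace X" "y \<in> mspace Y" "y' \<in> mspace Y"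
      then show "mdist Z (i x) (j y) \<le> mdist Z (i x) (j y') + mdist Y y' y"
        "mdist Y y y' \<le> mdist Z (i x) (j y) + mdist Z (i x) (j y')"
        using Z.triangle[of "i x" "j y'" "j y"] Z.triangle[of "j y" "i x" "j y'"]
          Z.commute[of "j y" "i x"]
        by (simp_all add: jZ in_Z jn_Z mdist_commute add.commute)
    qed simp
    show "\<exists>y\<in>mspace Y. mdist Z (i x) (j y) \<le> r" if "x \<in> mspace X" for x
    proof -
      \<comment> \<open>Real suprema are informative only for bounded sets; the bound
        \<open>K\<close> allows the infimum at \<open>i x\<close> to be compared with the Hausdorff
        distance.\<close>
      have "bdd_above ((\<lambda>a. INF b\<in>j ` mspace Y. mdist Z a b) ` i ` mspace X)"
      proof (rule bdd_aboveI2)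
        fix a assume "a \<in> i ` mspace X"
        moreover obtain y where "y \<in> mspace Y" using ne(2) by blast
        ultimately show "(INF b\<in>j ` mspace Y. mdist Z a b) \<le> K"
          using K by (intro cINF_lower2[where x = "j y"] bd) auto
      qed
      then have "(INF b\<in>j ` mspace Y. mdist Z (i x) b) \<le> hausdorff_dist Z (i ` mspace X) (j ` mspace Y)"
        unfolding hausdorff_dist_def using that
        by (intro max.coboundedI1 cSUP_upper) auto
      then have "(INF b\<in>j ` mspace Y. mdist Z (i x) b) < r" using h by linarith
      then show ?thesis
        using ne(2) by (subst (asm) cINF_less_iff) (auto intro: less_imp_le bd)
    qed
    show "\<exists>x\<in>mspace X. mdist Z (i x) (j y) \<le> r" if "y \<in> mspace Y" for y
    proof -
      have "bdd_above ((\<lambda>b. INF a\<in>i ` mspace X. mdist Z a b) ` j ` mspace Y)"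
      proof (rule bdd_aboveI2)
        fix b assume "b \<in> j ` mspace Y"
        moreover obtain x where "x \<in> mspace X" using ne(1) by blast
        ultimately show "(INF a\<in>i ` mspace X. mdist Z a b) \<le> K"
          using K by (intro cINF_lower2[where x = "i x"] bd) auto
      qed
      then have "(INF b\<in>i ` mspace X. mdist Z b (j y)) \<le> hausdorff_dist Z (i ` mspace X) (j ` mspace Y)"
        unfolding hausdorff_dist_def using that
        by (intro max.coboundedI2 cSUP_upper) auto
      then have "(INF b\<in>i ` mspace X. mdist Z b (j y)) < r" using h by linarith
      then show ?thesis
        using ne(1) by (subst (asm) cINF_less_iff) (auto intro: less_imp_le bd)
    qed
  qed
qed

section \<open>Attainment of the Gromov--Hausdorff distance\<close>

lemma closedin_Collect_ball:
  assumes "\<And>i. i \<in> J \<Longrightarrow> closedin T {c \<in> topspace T. P i c}"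
  shows "closedin T {c \<in> topspace T. \<forall>i\<in>J. P i c}"
proof -
  have "{c \<in> topspace T. \<forall>i\<in>J. P i c} = topspace T \<inter> (\<Inter>i\<in>J. {c \<in> topspace T. P i c})"
    by auto
  moreover have "closedin T (\<Inter>i\<in>J. {c \<in> topspace T. P i c})" if "J \<noteq> {}"
    using that assms by (intro closedin_Inter) auto
  ultimately show ?thesis
    by (cases "J = {}") (simp_all add: closedin_Int)
qed

lemma closedin_Collect_bex:
  assumes "finite J" "\<And>i. i \<in> J \<Longrightarrow> closedin T {c \<in> topspace T. P i c}"
  shows "closedin T {c \<in> topspace T. \<exists>i\<in>J. P i c}"
proof -
  have "{c \<in> topspace T. \<exists>i\<in>J. P i c} = (\<Union>i\<in>J. {c \<in> topspace T. P i c})"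
    by auto
  also have "closedin T \<dots>"
    using assms by (intro closedin_Union) auto
  finally show ?thesis .
qed

lemma closedin_Collect_conj:
  assumes "closedin T {c \<in> topspace T. P c}" "closedin T {c \<in> topspace T. Q c}"
  shows "closedin T {c \<in> topspace T. P c \<and> Q c}"
proof -
  have "{c \<in> topspace T. P c \<and> Q c} = {c \<in> topspace T. P c} \<inter> {c \<in> topspace T. Q c}"
    by auto
  then show ?thesis using closedin_Int[OF assms] by simp
qed

lemma closedin_Collect_le:
  fixes f g :: "'a \<Rightarrow> real"
  assumes "continuous_map T euclideanreal f" "continuous_map T euclideanreal g"
  shows "closedin T {c \<in> topspace T. f c \<le> g c}"
proof -
  have "closedin T {c \<in> topspace T. f c - g c \<in> {..0}}"
    using assms
    by (intro closedin_continuous_map_preimage[where Y = euclideanreal] continuous_map_diff) auto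
  then show ?thesis by simp
qed

text \<open>The one-sided hypothesis, applied to both orders of the two points, makes
  \<open>f\<close> 1-Lipschitz, hence continuous on a compact space. The cross distances of a
  coupling satisfy it in either variable.\<close>

lemma nonexpanding_attains_inf:
  assumes "ne_compact Y" and "\<And>y y'. y \<in> mspace Y \<Longrightarrow> y' \<in> mspace Y \<Longrightarrow> f y \<le> f y' + mdist Y y' y"
  shows "\<exists>y\<in>mspace Y. \<forall>y'\<in>mspace Y. f y \<le> (f y' :: real)"
proof -
  have "\<bar>f y - f y'\<bar> \<le> 1 * mdist Y y y'" if "y \<in> mspace Y" "y' \<in> mspace Y" for y y'
    using assms(2)[OF that] assms(2)[OF that(2,1)] mdist_commute[of Y y y'] by linarith
  then have "Lipschitz_continuous_map Y euclidean_metric f"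
    unfolding Lipschitz_continuous_map_def by (auto simp: dist_real_def intro!: exI[of _ 1])
  then have "continuous_map (mtopology_of Y) euclideanreal f"
    using Lipschitz_continuous_imp_continuous_map[of Y euclidean_metric f] by simp
  moreover have "compactin (mtopology_of Y) (mspace Y)"
    using assms(1) by (simp add: ne_compact_def compact_space_def)
  ultimately have "compact (f ` mspace Y)"
    by (metis image_compactin compactin_euclidean_iff)
  then show ?thesis
    using compact_attains_inf[of "f ` mspace Y"] assms(1) by (auto simp: ne_compact_def)
qed

lemma ne_compact_finite_net:
  assumes "ne_compact Y" "0 < \<epsilon>"
  obtains N where "finite N" "N \<subseteq> mspace Y" "\<And>y. y \<in> mspace Y \<Longrightarrow> \<exists>z\<in>N. mdist Y z y < \<epsilon>"
proof -
  interpret Metric_space "mspace Y" "mdist Y" by simp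
  have "mtotally_bounded (mspace Y)"
    using assms compact_space_eq_mcomplete_mtotally_bounded
    by (auto simp: ne_compact_def mtopology_of_def)
  then obtain N where "finite N" "N \<subseteq> mspace Y" "mspace Y \<subseteq> (\<Union>x\<in>N. mball x \<epsilon>)"
    using assms(2) unfolding mtotally_bounded_def by metis
  then show ?thesis using that[of N] by fastforce
qed

definition coupling_within :: "'a metric \<Rightarrow> 'b metric \<Rightarrow> real \<Rightarrow> ('a \<Rightarrow> 'b \<Rightarrow> real) \<Rightarrow> bool" where
  "coupling_within X Y r c \<longleftrightarrow> coupling X Y c \<and>
     (\<forall>x\<in>mspace X. \<exists>y\<in>mspace Y. c x y \<le> r) \<and> (\<forall>y\<in>mspace Y. \<exists>x\<in>mspace X. c x y \<le> r)"

lemma couplingD: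
  assumes "coupling X Y c"
  shows "x \<in> mspace X \<Longrightarrow> y \<in> mspace Y \<Longrightarrow> 0 \<le> c x y"
    and "x \<in> mspace X \<Longrightarrow> x' \<in> mspace X \<Longrightarrow> y \<in> mspace Y \<Longrightarrow> c x y \<le> mdist X x x' + c x' y"
    and "x \<in> mspace X \<Longrightarrow> x' \<in> mspace X \<Longrightarrow> y \<in> mspace Y \<Longrightarrow> mdist X x x' \<le> c x y + c x' y"
    and "x \<in> mspace X \<Longrightarrow> y' \<in> mspace Y \<Longrightarrow> y \<in> mspace Y \<Longrightarrow> c x y \<le> c x y' + mdist Y y' y"
    and "x \<in> mspace X \<Longrightarrow> y' \<in> mspace Y \<Longrightarrow> y \<in> mspace Y \<Longrightarrow> mdist Y y y' \<le> c x y + c x y'"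
proof -
  note c = assms[unfolded coupling_def]
  note c1 = c[THEN conjunct1, rule_format]
    and c2 = c[THEN conjunct2, THEN conjunct1, rule_format]
    and c3 = c[THEN conjunct2, THEN conjunct2, rule_format]
  show "x \<in> mspace X \<Longrightarrow> y \<in> mspace Y \<Longrightarrow> 0 \<le> c x y" by (rule c1)
  show "x \<in> mspace X \<Longrightarrow> x' \<in> mspace X \<Longrightarrow> y \<in> mspace Y \<Longrightarrow> c x y \<le> mdist X x x' + c x' y"
    by (rule c2[THEN conjunct1])
  show "x \<in> mspace X \<Longrightarrow> x' \<in> mspace X \<Longrightarrow> y \<in> mspace Y \<Longrightarrow> mdist X x x' \<le> c x y + c x' y"
    by (rule c2[THEN conjunct2])
  show "x \<in> mspace X \<Longrightarrow> y' \<in> mspace Y \<Longrightarrow> y \<in> mspace Y \<Longrightarrow> c x y \<le> c x y' + mdist Y y' y"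
    by (rule c3[THEN conjunct1])
  show "x \<in> mspace X \<Longrightarrow> y' \<in> mspace Y \<Longrightarrow> y \<in> mspace Y \<Longrightarrow> mdist Y y y' \<le> c x y + c x y'"
    by (rule c3[THEN conjunct2])
qed

text \<open>
  The cross distances of the couplings live in a Tychonoff cube. The existence of a partner within
  distance \<open>r\<close> is not closed under pointwise limits; restricting the partners to a finite net, at the
  price of a larger \<open>r\<close>, makes it so.
\<close>

lemma coupling_within_limit:
  assumes X: "ne_compact X" and Y: "ne_compact Y"
    and "\<And>r. D < r \<Longrightarrow> \<exists>c. coupling_within X Y r c"
  shows "\<exists>c. coupling_within X Y D c"
proof -
  obtain L where L: "\<And>x y. x \<in> mspace X \<Longrightarrow> y \<in> mspace X \<Longrightarrow> mdist X x y \<le> L"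
    using mdist_le_of_ne_compact[OF X] by blast
  \<comment> \<open>A bound for the cross distances of the couplings considered: at most
    \<open>L\<close> from \<open>x\<close> to a partner of \<open>y\<close>, then at most
    \<open>D + 1\<close> across.\<close>
  define K where "K = L + D + 1"
  let ?e = "\<lambda>n::nat. 1 / real (Suc n)"
  have "\<exists>N. finite N \<and> N \<subseteq> mspace Y \<and> (\<forall>y\<in>mspace Y. \<exists>z\<in>N. mdist Y z y < ?e n)" for n
    by (rule ne_compact_finite_net[OF Y, of "?e n"]) auto
  then obtain N where N: "\<And>n. finite (N n)" "\<And>n. N n \<subseteq> mspace Y"
      "\<And>n y. y \<in> mspace Y \<Longrightarrow> \<exists>z\<in>N n. mdist Y z y < ?e n"
    by metis
  have "\<exists>N. finite N \<and> N \<subseteq> mspace X \<and> (\<forall>y\<in>mspace X. \<exists>z\<in>N. mdist X z y < ?e n)" for n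
    by (rule ne_compact_finite_net[OF X, of "?e n"]) auto
  then obtain M where M: "\<And>n. finite (M n)" "\<And>n. M n \<subseteq> mspace X"
      "\<And>n y. y \<in> mspace X \<Longrightarrow> \<exists>z\<in>M n. mdist X z y < ?e n"
    by metis
  define T where "T = product_topology (\<lambda>_. top_of_set {0..K}) (mspace X \<times> mspace Y)"
  have "compact_space T"
    unfolding T_def compact_space_product_topology
    by (auto simp: compact_space_subtopology)
  \<comment> \<open>One summand \<open>?e n\<close> pays for the coupling being only nearly optimal,
    the other for moving a partner into the net.\<close>
  define S where "S n = {c \<in> topspace T. coupling X Y (\<lambda>x y. c (x, y)) \<and>
     (\<forall>x\<in>mspace X. \<exists>y\<in>N n. c (x, y) \<le> D + 2 * ?e n) \<and>
     (\<forall>y\<in>mspace Y. \<exists>x\<in>M n. c (x, y) \<le> D + 2 * ?e n)}" for n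
  have co: "continuous_map T euclideanreal (\<lambda>c. c (x, y))"
    if "x \<in> mspace X" "y \<in> mspace Y" for x y
  proof -
    have "continuous_map T (top_of_set {0..K}) (\<lambda>c. c (x, y))"
      unfolding T_def using that by (intro continuous_map_product_coordinates) simp
    then show ?thesis by (rule continuous_map_into_fulltopology)
  qed
  have cl: "closedin T (S n)" for n
    unfolding S_def coupling_def
    using N(2) M(2)
    by (intro closedin_Collect_conj closedin_Collect_ball closedin_Collect_bex closedin_Collect_le
        continuous_map_add co continuous_map_canonical_const N(1) M(1)) auto
  have "\<Inter> \<F> \<noteq> {}" if F: "finite \<F>" "\<F> \<subseteq> range S" for \<F>
  proof -
    obtain J where J: "finite J" "\<F> = S ` J" using F finite_subset_image by metis
    \<comment> \<open>A single coupling with error \<open>?e m\<close> lies in all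
      \<open>S n\<close> with \<open>n\<close> in \<open>J\<close>; inserting 0 gives
      \<open>m\<close> a value when \<open>J\<close> is empty.\<close>
    define m where "m = Max (insert 0 J)"
    have m: "n \<le> m" if "n \<in> J" for n using J(1) that by (simp add: m_def)
    have "D < D + ?e m" by simp
    then obtain c where c: "coupling X Y c"
      "\<And>x. x \<in> mspace X \<Longrightarrow> \<exists>y\<in>mspace Y. c x y \<le> D + ?e m"
      "\<And>y. y \<in> mspace Y \<Longrightarrow> \<exists>x\<in>mspace X. c x y \<le> D + ?e m"
      using assms(3)[of "D + ?e m"] unfolding coupling_within_def by blast
    \<comment> \<open>Points of a product topology are extensional functions, hence the
      restriction.\<close>
    let ?c = "restrict (\<lambda>(x, y). c x y) (mspace X \<times> mspace Y)"
    have "c x y \<le> K" if xy: "x \<in> mspace X" "y \<in> mspace Y" for x y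
    proof -
      obtain x' where x': "x' \<in> mspace X" "c x' y \<le> D + ?e m" using c(3)[OF xy(2)] by blast
      have "?e m \<le> 1" by simp
      then show ?thesis
        using couplingD(2)[OF c(1) xy(1) x'(1) xy(2)] L[OF xy(1) x'(1)] x'(2) unfolding K_def
        by linarith
    qed
    then have top: "?c \<in> topspace T"
      using couplingD(1)[OF c(1)] by (auto simp: T_def)
    have cp: "coupling X Y (\<lambda>x y. ?c (x, y))"
      using c(1) unfolding coupling_def by simp
    have "?c \<in> S n" if n: "n \<in> J" for n
    proof -
      have e: "?e m \<le> ?e n" using m[OF n] by (simp add: frac_le)
      have "\<exists>y\<in>N n. ?c (x, y) \<le> D + 2 * ?e n" if x: "x \<in> mspace X" for x
      proof -
        obtain y where y: "y \<in> mspace Y" "c x y \<le> D + ?e m" using c(2)[OF x] by blast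
        obtain z where z: "z \<in> N n" "mdist Y z y < ?e n" using N(3)[OF y(1)] by blast
        then have "z \<in> mspace Y" using N(2) by blast
        then have "c x z \<le> D + 2 * ?e n"
          using couplingD(4)[OF c(1) x y(1), of z] y z e mdist_commute[of Y y z] by linarith
        then show ?thesis using z(1) x \<open>z \<in> mspace Y\<close> by auto
      qed
      moreover have "\<exists>x\<in>M n. ?c (x, y) \<le> D + 2 * ?e n" if y: "y \<in> mspace Y" for y
      proof -
        obtain x where x: "x \<in> mspace X" "c x y \<le> D + ?e m" using c(3)[OF y] by blast
        obtain z where z: "z \<in> M n" "mdist X z x < ?e n" using M(3)[OF x(1)] by blast
        then have "z \<in> mspace X" using M(2) by blast
        then have "c z y \<le> D + 2 * ?e n"
          using couplingD(2)[OF c(1) _ x(1) y, of z] x z e by linarith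
        then show ?thesis using z(1) y \<open>z \<in> mspace X\<close> by auto
      qed
      ultimately show ?thesis using top cp unfolding S_def by blast
    qed
    then show ?thesis unfolding J(2) by blast
  qed
  then have "\<Inter> (range S) \<noteq> {}"
    using \<open>compact_space T\<close>[unfolded compact_space_fip, THEN spec, of "range S"] cl by simp
  then obtain c where c: "c \<in> S n" for n by auto
  have cp: "coupling X Y (\<lambda>x y. c (x, y))" using c[of 0] by (simp add: S_def)
  have arch: "a \<le> D" if "\<And>n. a \<le> D + 2 * ?e n" for a
  proof (rule field_le_epsilon)
    fix \<epsilon> :: real assume "0 < \<epsilon>"
    then obtain n where "?e n < \<epsilon> / 2" using nat_approx_posE half_gt_zero by blast
    then show "a \<le> D + \<epsilon>" using that[of n] by simp
  qed
  have "coupling_within X Y D (\<lambda>x y. c (x, y))"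
    unfolding coupling_within_def
  proof (intro conjI ballI)
    fix x assume x: "x \<in> mspace X"
    \<comment> \<open>The partner in the net varies with \<open>n\<close>; a minimiser over all of
      \<open>mspace Y\<close> is at least as good as each of them.\<close>
    obtain y where y: "y \<in> mspace Y" "\<And>y'. y' \<in> mspace Y \<Longrightarrow> c (x, y) \<le> c (x, y')"
      using nonexpanding_attains_inf[OF Y, of "\<lambda>y. c (x, y)"] couplingD(4)[OF cp x] by blast
    have "c (x, y) \<le> D + 2 * ?e n" for n
      using c[of n] x y(2) N(2)[of n] unfolding S_def by fastforce
    then show "\<exists>y\<in>mspace Y. c (x, y) \<le> D" using arch y(1) by blast
  next
    fix y assume y: "y \<in> mspace Y"
    have "c (x, y) \<le> c (x', y) + mdist X x' x" if "x \<in> mspace X" "x' \<in> mspace X" for x x'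
      using couplingD(2)[OF cp that y] by (simp add: add.commute mdist_commute)
    then obtain x where x: "x \<in> mspace X" "\<And>x'. x' \<in> mspace X \<Longrightarrow> c (x, y) \<le> c (x', y)"
      using nonexpanding_attains_inf[OF X, of "\<lambda>x. c (x, y)"] by blast
    have "c (x, y) \<le> D + 2 * ?e n" for n
      using c[of n] y x(2) M(2)[of n] unfolding S_def by fastforce
    then show "\<exists>x\<in>mspace X. c (x, y) \<le> D" using arch x(1) by blast
  qed (rule cp)
  then show ?thesis by blast
qed

text \<open>Partners at coupling distance 0 are identified points of the common pseudometric space,
  so choosing partners gives an isometry.\<close>

lemma coupling_within_0_imp_isometric:
  assumes "coupling_within X Y 0 c"
  shows "isometric X Y"
proof -
  have c: "coupling X Y c" using assms by (simp add: coupling_within_def)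
  obtain f where f: "\<And>x. x \<in> mspace X \<Longrightarrow> f x \<in> mspace Y \<and> c x (f x) \<le> 0"
    using assms unfolding coupling_within_def by metis
  have iso: "mdist Y (f x) (f x') = mdist X x x'" if x: "x \<in> mspace X" "x' \<in> mspace X" for x x'
    using couplingD(3)[OF c x, of "f x'"] couplingD(5)[OF c x(1), of "f x'" "f x"]
      couplingD(2)[OF c x, of "f x'"] couplingD(4)[OF c x(1), of "f x'" "f x"]
      couplingD(4)[OF c x(1), of "f x" "f x'"] couplingD(2)[OF c x(2,1), of "f x"]
      f[OF x(1)] f[OF x(2)] couplingD(1)[OF c x(1), of "f x"] couplingD(1)[OF c x(2), of "f x'"]
      mdist_commute[of Y "f x" "f x'"]
    by simp
  have "y \<in> f ` mspace X" if y: "y \<in> mspace Y" for y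
  proof -
    obtain x where x: "x \<in> mspace X" "c x y \<le> 0" using assms y unfolding coupling_within_def by blast
    have "mdist Y (f x) y \<le> 0"
      using couplingD(5)[OF c x(1) y, of "f x"] f[OF x(1)] x(2) by auto
    then have "f x = y" using f[OF x(1)] y by (metis mdist_nonneg mdist_zero order_antisym)
    then show ?thesis using x(1) by blast
  qed
  then have "f ` mspace X = mspace Y" using f by blast
  then show ?thesis
    using iso unfolding isometric_def isometric_embedding_def by (intro exI[of _ f]) simp
qed

section \<open>The metric on isometry classes\<close>

lemma gh_close_mono:
  assumes "gh_close X Y r" "r \<le> s"
  shows "gh_close X Y s"
proof -
  obtain R where R: "correspondence X Y R"
      "\<And>x y x' y'. (x, y) \<in> R \<Longrightarrow> (x', y') \<in> R \<Longrightarrow> \<bar>mdist X x x' - mdist Y y y'\<bar> \<le> 2 * r"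
    using assms(1) unfolding gh_close_def by fast
  have "\<bar>mdist X x x' - mdist Y y y'\<bar> \<le> 2 * s" if "(x, y) \<in> R" "(x', y') \<in> R" for x y x' y'
    using R(2)[OF that] assms(2) by linarith
  then show ?thesis
    using R(1) unfolding gh_close_def by (intro exI[of _ R]) auto
qed

lemma gh_close_nonneg:
  assumes "gh_close X Y r" "mspace X \<noteq> {}"
  shows "0 \<le> r"
proof -
  obtain R where R: "correspondence X Y R"
      "\<And>x y x' y'. (x, y) \<in> R \<Longrightarrow> (x', y') \<in> R \<Longrightarrow> \<bar>mdist X x x' - mdist Y y y'\<bar> \<le> 2 * r"
    using assms(1) unfolding gh_close_def by fast
  obtain x y where "(x, y) \<in> R" using correspondence_left[OF R(1)] assms(2) by blast
  then have "\<bar>mdist X x x - mdist Y y y\<bar> \<le> 2 * r" using R(2) by blast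
  then show ?thesis by linarith
qed

section \<open>Isometry classes of spaces over arbitrary carrier types\<close>

lemma ne_compact_isometric:
  assumes "isometric X Y" "ne_compact X"
  shows "ne_compact Y"
proof -
  have "mspace Y \<noteq> {}"
    using assms unfolding isometric_def ne_compact_def by (metis image_is_empty)
  then show ?thesis
    using isometric_imp_homeomorphic_space[OF assms(1)] assms(2) homeomorphic_compact_space
    unfolding ne_compact_def by blast
qed

text \<open>Assigns a class to metrics over any carrier type, in particular over
  \<open>nat \<Rightarrow> bool\<close>, by choosing an isometric copy on the reals. For nonempty
  compact spaces the class depends on the isometry type alone, by
  \<open>gh_class_eq_iff\<close>.\<close>

definition gh_class :: "'a metric \<Rightarrow> gh_space" where
  "gh_class m = abs_gh_space (SOME m'. isometric m m')"

lemma gh_class_real: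
  assumes "ne_compact m"
  obtains m' :: "real metric" where "isometric m m'" "ne_compact m'" "gh_class m = abs_gh_space m'"
proof -
  let ?m = "SOME m' :: real metric. isometric m m'"
  have "isometric m ?m"
    using ne_compact_isometric_real[OF assms] by (rule someI_ex)
  moreover have "gh_class m = abs_gh_space ?m"
    by (simp add: gh_class_def)
  ultimately show ?thesis
    using that ne_compact_isometric[OF _ assms] by blast
qed

lemma abs_gh_space_eq_iff:
  assumes "ne_compact X" "ne_compact Y"
  shows "abs_gh_space X = abs_gh_space Y \<longleftrightarrow> isometric X Y"
  using Quotient_rel[OF Quotient_gh_space, of X Y] assms
  by (simp add: gh_rel_def isometric_refl)

lemma gh_class_surj:
  obtains m :: "real metric" where "ne_compact m" "X = gh_class m"
proof -
  have "\<exists>m :: real metric. ne_compact m \<and> X = abs_gh_space m"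
    by (induct X rule: gh_space.abs_induct) (auto simp: gh_rel_def)
  then obtain m :: "real metric" where m: "ne_compact m" "X = abs_gh_space m" by blast
  then show ?thesis
    using that[OF m(1)] gh_class_real[OF m(1)] abs_gh_space_eq_iff by metis
qed

lemma gh_class_eq_iff:
  assumes "ne_compact X" "ne_compact Y"
  shows "gh_class X = gh_class Y \<longleftrightarrow> isometric X Y"
proof -
  obtain X' :: "real metric" where X': "isometric X X'" "ne_compact X'" "gh_class X = abs_gh_space X'"
    using gh_class_real[OF assms(1)] by blast
  obtain Y' :: "real metric" where Y': "isometric Y Y'" "ne_compact Y'" "gh_class Y = abs_gh_space Y'"
    using gh_class_real[OF assms(2)] by blast
  have "isometric X Y" if "isometric X' Y'"
    by (rule isometric_trans[OF X'(1) isometric_trans[OF that isometric_sym[OF Y'(1)]]])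
  moreover have "isometric X' Y'" if "isometric X Y"
    by (rule isometric_trans[OF isometric_sym[OF X'(1)] isometric_trans[OF that Y'(1)]])
  ultimately show ?thesis
    unfolding X'(3) Y'(3) abs_gh_space_eq_iff[OF X'(2) Y'(2)] by blast
qed

lemma gh_class_in_CA_iff:
  assumes "ne_compact X"
  shows "gh_class X \<in> CA \<longleftrightarrow> cantor_metric_space X"
proof -
  obtain m :: "real metric" where m: "isometric X m" "ne_compact m" "gh_class X = abs_gh_space m"
    using gh_class_real[OF assms] by blast
  have "gh_class X \<in> CA \<longleftrightarrow> cantor_metric_space m"
    unfolding m(3) CA_def mem_Collect_eq
    by (rule cantor_class.abs_eq) (simp add: gh_rel_def m(2) isometric_refl)
  then show ?thesis
    using isometric_imp_homeomorphic_space[OF m(1)] unfolding cantor_metric_space_def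
    by (meson homeomorphic_space_sym homeomorphic_space_trans)
qed

lemma gh_dist_abs:
  assumes "ne_compact X" "ne_compact Y"
  shows "gh_dist (abs_gh_space X) (abs_gh_space Y) = gh_distance X Y"
  using assms isometric_refl by (intro gh_dist.abs_eq) (simp_all add: gh_rel_def)

lemma gh_dist_class_le:
  assumes X: "ne_compact X" and Y: "ne_compact Y" and r: "gh_close X Y r"
  shows "gh_dist (gh_class X) (gh_class Y) \<le> r"
\<comment> \<open>The value \<open>r = 0\<close> must be covered, while the passage to
  \<open>gh_distance\<close> needs a positive bound.\<close>
proof (rule field_le_epsilon)
  fix e :: real assume "0 < e"
  obtain X' :: "real metric" where X': "isometric X X'" "ne_compact X'" "gh_class X = abs_gh_space X'"
    using gh_class_real[OF X] by blast
  obtain Y' :: "real metric" where Y': "isometric Y Y'" "ne_compact Y'" "gh_class Y = abs_gh_space Y'"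
    using gh_class_real[OF Y] by blast
  have "gh_close X' Y' (0 + (r + 0))"
    by (rule gh_close_trans[OF isometric_imp_gh_close[OF isometric_sym[OF X'(1)]]
          gh_close_trans[OF r isometric_imp_gh_close[OF Y'(1)]]])
  then have "gh_close X' Y' (r + e)"
    by (rule gh_close_mono) (use \<open>0 < e\<close> in simp)
  moreover have "0 \<le> r" using gh_close_nonneg[OF r] X by (simp add: ne_compact_def)
  ultimately show "gh_dist (gh_class X) (gh_class Y) \<le> r + e"
    using X' Y' gh_close_imp_gh_distance_le[OF X'(2) Y'(2)] \<open>0 < e\<close> by (simp add: gh_dist_abs)
qed

lemma gh_dist_class_less:
  assumes X: "ne_compact X" and Y: "ne_compact Y" and r: "gh_dist (gh_class X) (gh_class Y) < r"
  shows "gh_close X Y r"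
proof -
  obtain X' :: "real metric" where X': "isometric X X'" "ne_compact X'" "gh_class X = abs_gh_space X'"
    using gh_class_real[OF X] by blast
  obtain Y' :: "real metric" where Y': "isometric Y Y'" "ne_compact Y'" "gh_class Y = abs_gh_space Y'"
    using gh_class_real[OF Y] by blast
  have "gh_distance X' Y' < r" using r X' Y' by (simp add: gh_dist_abs)
  then have "gh_close X' Y' r"
    using gh_distance_less_imp_coupling[OF X'(2) Y'(2)] coupling_imp_gh_close by metis
  then have "gh_close X Y (0 + (r + 0))"
    by (rule gh_close_trans[OF isometric_imp_gh_close[OF X'(1)]
          gh_close_trans[OF _ isometric_imp_gh_close[OF isometric_sym[OF Y'(1)]]]])
  then show ?thesis by simp
qed

text \<open>The distance is attained: couplings exist for every larger value and pass to the limit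
  by \<open>coupling_within_limit\<close>.\<close>

lemma gh_dist_class_coupling:
  assumes X: "ne_compact X" and Y: "ne_compact Y"
  shows "\<exists>c. coupling_within X Y (gh_dist (gh_class X) (gh_class Y)) c"
proof (rule coupling_within_limit[OF X Y])
  fix r assume r: "gh_dist (gh_class X) (gh_class Y) < r"
  obtain s where s: "gh_dist (gh_class X) (gh_class Y) < s" "s < r" using dense[OF r] by blast
  have ne: "mspace X \<noteq> {}" using X by (simp add: ne_compact_def)
  have "0 \<le> s" using gh_close_nonneg[OF gh_dist_class_less[OF X Y s(1)] ne] .
  then have "0 < r" using s(2) by simp
  show "\<exists>c. coupling_within X Y r c"
    by (rule gh_close_imp_coupling[OF gh_dist_class_less[OF X Y r] \<open>0 < r\<close> ne])
      (auto simp: coupling_within_def)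
qed

lemma Metric_space_gh_dist: "Metric_space UNIV gh_dist"
proof
  fix X Y Z :: gh_space
  obtain x :: "real metric" where x: "ne_compact x" "X = gh_class x" using gh_class_surj by metis
  obtain y :: "real metric" where y: "ne_compact y" "Y = gh_class y" using gh_class_surj by metis
  obtain z :: "real metric" where z: "ne_compact z" "Z = gh_class z" using gh_class_surj by metis
  have nonneg: "0 \<le> gh_dist (gh_class x) (gh_class y)"
    if "ne_compact x" "ne_compact y" for x y :: "real metric"
  proof (rule field_le_epsilon)
    fix e :: real assume "0 < e"
    then show "0 \<le> gh_dist (gh_class x) (gh_class y) + e"
      using that gh_close_nonneg[OF gh_dist_class_less[OF that]] by (simp add: ne_compact_def)
  qed
  then show "0 \<le> gh_dist X Y" using x y by simp
  have sym: "gh_dist (gh_class x) (gh_class y) \<le> gh_dist (gh_class y) (gh_class x)"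
    if "ne_compact x" "ne_compact y" for x y :: "real metric"
    by (rule field_le_epsilon)
      (use that in \<open>auto intro!: gh_dist_class_le gh_close_sym[OF gh_dist_class_less]\<close>)
  show "gh_dist X Y = gh_dist Y X" using sym x y by (simp add: order_antisym)
  show "gh_dist X Y = 0 \<longleftrightarrow> X = Y"
  proof
    assume "gh_dist X Y = 0"
    then have "\<exists>c. coupling_within x y 0 c"
      using gh_dist_class_coupling[OF x(1) y(1)] x y by simp
    then show "X = Y"
      using coupling_within_0_imp_isometric gh_class_eq_iff x y by blast
  next
    assume "X = Y"
    then have "gh_dist X Y \<le> 0"
      using gh_dist_class_le[OF x(1) x(1) isometric_imp_gh_close[OF isometric_refl]] x by simp
    then show "gh_dist X Y = 0" using nonneg[OF x(1) y(1)] x y by simp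
  qed
  show "gh_dist X Z \<le> gh_dist X Y + gh_dist Y Z"
  proof (rule field_le_epsilon)
    fix e :: real assume e: "0 < e"
    have "gh_close x z ((gh_dist X Y + e / 2) + (gh_dist Y Z + e / 2))"
      using e x y z by (intro gh_close_trans[of x y _ z] gh_dist_class_less) auto
    then show "gh_dist X Z \<le> gh_dist X Y + gh_dist Y Z + e"
      using gh_dist_class_le[OF x(1) z(1)] x z by (simp add: algebra_simps)
  qed
qed

section \<open>The Cantor set as a sequence space\<close>

text \<open>Agreement on the first \<open>n\<close> digits describes the cylinders of length
  \<open>n\<close>; all uniform continuity on the space of binary sequences is expressed through
  it.\<close>

definition agree :: "nat \<Rightarrow> (nat \<Rightarrow> bool) \<Rightarrow> (nat \<Rightarrow> bool) \<Rightarrow> bool" where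
  "agree n z z' \<longleftrightarrow> (\<forall>i<n. z i = z' i)"

lemma agree_refl [simp]: "agree n z z"
  by (simp add: agree_def)

lemma agree_sym: "agree n z z' \<Longrightarrow> agree n z' z"
  by (simp add: agree_def)

lemma agree_trans: "agree n z z' \<Longrightarrow> agree n z' z'' \<Longrightarrow> agree n z z''"
  by (simp add: agree_def)

lemma agree_mono: "agree n z z' \<Longrightarrow> m \<le> n \<Longrightarrow> agree m z z'"
  by (simp add: agree_def)

lemma agree_Suc_shift: "agree (Suc n) z z' \<longleftrightarrow> z 0 = z' 0 \<and> agree n (z \<circ> Suc) (z' \<circ> Suc)"
  by (auto simp: agree_def less_Suc_eq_0_disj)

lemma agree_Suc: "agree (Suc n) z z' \<longleftrightarrow> agree n z z' \<and> z n = z' n"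
  by (auto simp: agree_def less_Suc_eq)

lemma ex_not_agree:
  assumes "z \<noteq> z'"
  shows "\<exists>n. \<not> agree n z z'"
  using assms by (auto simp: agree_def fun_eq_iff)

section \<open>Ternary coding of the Cantor set by the digits 0 and 2\<close>

definition cantor_code :: "(nat \<Rightarrow> bool) \<Rightarrow> real" where
  "cantor_code z = (\<Sum>k. (if z k then 2 else 0) / 3 ^ Suc k)"

lemma cantor_code_summable: "summable (\<lambda>k. (if z k then 2 else 0) / 3 ^ Suc k :: real)"
proof (rule summable_comparison_test')
  show "summable (\<lambda>k. (1 / 3 :: real) ^ k)" by (rule summable_geometric) simp
  show "norm ((if z k then 2 else 0) / 3 ^ Suc k :: real) \<le> (1 / 3) ^ k" if "k \<ge> 0" for k
    by (simp add: power_one_over divide_simps)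
qed

lemma cantor_code_rec: "cantor_code z = ((if z 0 then 2 else 0) + cantor_code (z \<circ> Suc)) / 3"
proof -
  have "(\<Sum>k. (if z (Suc k) then 2 else 0) / 3 ^ Suc (Suc k) :: real)
      = (\<Sum>k. ((if z (Suc k) then 2 else 0) / 3 ^ Suc k) / 3)"
    by (rule suminf_cong) simp
  also have "\<dots> = cantor_code (z \<circ> Suc) / 3"
    unfolding cantor_code_def using cantor_code_summable[of "z \<circ> Suc"]
    by (subst suminf_divide) (simp_all add: comp_def)
  finally show ?thesis
    using suminf_split_head[OF cantor_code_summable[of z]] unfolding cantor_code_def
    by (simp add: add_divide_distrib)
qed

lemma cantor_code_nonneg: "0 \<le> cantor_code z"
  unfolding cantor_code_def by (intro suminf_nonneg cantor_code_summable) simp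

lemma cantor_code_le_1: "cantor_code z \<le> 1"
proof -
  have s: "(\<lambda>k. 2 / 3 * (1 / 3 :: real) ^ k) sums (2 / 3 * (1 / (1 - 1 / 3)))"
    by (intro sums_mult geometric_sums) simp
  have "cantor_code z \<le> (\<Sum>k. 2 / 3 * (1 / 3 :: real) ^ k)"
    unfolding cantor_code_def
    by (intro suminf_le cantor_code_summable sums_summable[OF s])
      (simp add: power_one_over divide_simps)
  also have "\<dots> = 1" using sums_unique[OF s] by simp
  finally show ?thesis .
qed

lemma agree_imp_cantor_code_close:
  "agree n z z' \<Longrightarrow> \<bar>cantor_code z - cantor_code z'\<bar> \<le> (1 / 3) ^ n"
proof (induction n arbitrary: z z')
  case 0
  then show ?case
    using cantor_code_nonneg[of z] cantor_code_nonneg[of z'] cantor_code_le_1[of z]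
      cantor_code_le_1[of z'] by simp
next
  case (Suc n)
  then have "z 0 = z' 0" "\<bar>cantor_code (z \<circ> Suc) - cantor_code (z' \<circ> Suc)\<bar> \<le> (1 / 3) ^ n"
    by (auto simp: agree_Suc_shift)
  then show ?case
    by (subst (1 2) cantor_code_rec) (simp add: diff_divide_distrib[symmetric])
qed

text \<open>Different leading digits force codes at least 1/3 apart, and equal ones allow rescaling
  by 3. The strict inequality matters: 1/3 and 2/3 are codes at distance exactly 1/3 with different
  leading digits.\<close>

lemma cantor_code_close_imp_agree:
  "\<bar>cantor_code z - cantor_code z'\<bar> < (1 / 3) ^ n \<Longrightarrow> agree n z z'"
proof (induction n arbitrary: z z')
  case 0
  then show ?case by (simp add: agree_def)
next
  case (Suc n)
  let ?a = "cantor_code (z \<circ> Suc)" and ?b = "cantor_code (z' \<circ> Suc)"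
  have ab: "0 \<le> ?a" "?a \<le> 1" "0 \<le> ?b" "?b \<le> 1"
    by (rule cantor_code_nonneg cantor_code_le_1)+
  define p where "p = (1 / 3 :: real) ^ n"
  have p: "p \<le> 1" unfolding p_def by (simp add: power_le_one)
  have "\<bar>((if z 0 then 2 else 0) + ?a) / 3 - ((if z' 0 then 2 else 0) + ?b) / 3\<bar> < p / 3"
    using Suc.prems cantor_code_rec[of z] cantor_code_rec[of z'] by (simp add: p_def)
  then have lt: "\<bar>(if z 0 then 2 else 0) - (if z' 0 then 2 else 0) + (?a - ?b)\<bar> < p"
    by (simp add: diff_divide_distrib[symmetric] algebra_simps split del: if_split)
  have "z 0 = z' 0"
    using lt ab p by (cases "z 0"; cases "z' 0"; simp; linarith)
  moreover from this have "\<bar>?a - ?b\<bar> < (1 / 3) ^ n"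
    using lt unfolding p_def by simp
  ultimately show ?case
    using Suc.IH by (simp add: agree_Suc_shift)
qed

lemma cantor_code_inj: "inj cantor_code"
proof (rule injI, rule ccontr)
  fix z z' assume "cantor_code z = cantor_code z'" "z \<noteq> z'"
  moreover obtain n where "\<not> agree n z z'" using ex_not_agree[OF \<open>z \<noteq> z'\<close>] by blast
  ultimately show False using cantor_code_close_imp_agree[of z z' n] by simp
qed

lemma cantor_code_in_step: "cantor_code z \<in> cantor_step n"
proof (induction n arbitrary: z)
  case 0
  then show ?case using cantor_code_nonneg cantor_code_le_1 by simp
next
  case (Suc n)
  have "cantor_code z = (if z 0 then (cantor_code (z \<circ> Suc) + 2) / 3 else cantor_code (z \<circ> Suc) / 3)"
    using cantor_code_rec[of z] by simp
  then show ?case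
    by (auto intro: rev_image_eqI[OF Suc[of "z \<circ> Suc"]])
qed

text \<open>The expanding map that deletes the leading ternary digit. Points of the Cantor set avoid
  the open middle third, so the cut at 1/2 separates leading digit 0 from leading digit 2.\<close>

definition cantor_shift :: "real \<Rightarrow> real" where
  "cantor_shift x = (if x \<le> 1 / 2 then 3 * x else 3 * x - 2)"

lemma cantor_step_subset: "cantor_step n \<subseteq> {0..1}"
  by (induction n) force+

lemma cantor_shift_in_cantor_set:
  assumes "x \<in> cantor_set"
  shows "cantor_shift x \<in> cantor_set"
  unfolding cantor_set_def
proof
  fix n
  have "x \<in> cantor_step (Suc n)" using assms unfolding cantor_set_def by blast
  then obtain y where y: "y \<in> cantor_step n" "x = y / 3 \<or> x = (y + 2) / 3" by auto
  moreover have "0 \<le> y" "y \<le> 1" using cantor_step_subset y(1) by fastforce+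
  ultimately have "cantor_shift x = y" by (auto simp: cantor_shift_def)
  then show "cantor_shift x \<in> cantor_step n" using y(1) by simp
qed

text \<open>Iterating the shift reads off the digits. Point and code share the leading digit, so
  each shift multiplies their difference by 3 while it stays bounded by 1.\<close>

lemma cantor_code_digits:
  assumes "x \<in> cantor_set"
  shows "\<bar>x - cantor_code (\<lambda>k. \<not> (cantor_shift ^^ k) x \<le> 1 / 2)\<bar> \<le> (1 / 3) ^ n"
  using assms
proof (induction n arbitrary: x)
  case 0
  then have "x \<in> cantor_step 0" unfolding cantor_set_def by blast
  then have "0 \<le> x" "x \<le> 1" by simp_all
  then show ?case
    using cantor_code_nonneg[of "\<lambda>k. \<not> (cantor_shift ^^ k) x \<le> 1 / 2"]
      cantor_code_le_1[of "\<lambda>k. \<not> (cantor_shift ^^ k) x \<le> 1 / 2"] by (simp add: abs_le_iff)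
next
  case (Suc n)
  let ?z = "\<lambda>x k. \<not> (cantor_shift ^^ k) x \<le> 1 / 2"
  have shift: "?z x \<circ> Suc = ?z (cantor_shift x)"
    by (rule ext) (simp add: funpow_swap1)
  have "cantor_code (?z x) = ((if x \<le> 1 / 2 then 0 else 2) + cantor_code (?z (cantor_shift x))) / 3"
    by (subst cantor_code_rec) (simp only: shift, simp)
  moreover have "x = ((if x \<le> 1 / 2 then 0 else 2) + cantor_shift x) / 3"
    by (simp add: cantor_shift_def)
  moreover have "\<bar>u - v\<bar> = \<bar>u' - v'\<bar> / 3" if "v = (d + v') / 3" "u = (d + u') / 3" for u v u' v' d :: real
    using that by argo
  ultimately have "\<bar>x - cantor_code (?z x)\<bar> = \<bar>cantor_shift x - cantor_code (?z (cantor_shift x))\<bar> / 3"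
    by blast
  then show ?case
    using Suc.IH[OF cantor_shift_in_cantor_set[OF Suc.prems]] by simp
qed

lemma range_cantor_code: "range cantor_code = cantor_set"
proof
  show "range cantor_code \<subseteq> cantor_set"
    using cantor_code_in_step by (auto simp: cantor_set_def)
  show "cantor_set \<subseteq> range cantor_code"
  proof
    fix x assume x: "x \<in> cantor_set"
    let ?c = "cantor_code (\<lambda>k. \<not> (cantor_shift ^^ k) x \<le> 1 / 2)"
    have "(\<lambda>n. (1 / 3 :: real) ^ n) \<longlonglongrightarrow> 0" by (rule LIMSEQ_realpow_zero) auto
    then have "\<bar>x - ?c\<bar> \<le> 0"
      by (rule LIMSEQ_le_const) (use cantor_code_digits[OF x] in blast)
    then have "x = ?c" by simp
    then show "x \<in> range cantor_code" by (metis rangeI)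
  qed
qed

section \<open>Parametrising Cantor metric spaces by binary sequences\<close>

lemma compact_cantor_set: "compact cantor_set"
proof -
  have c: "compact (cantor_step n)" for n
    by (induction n) (auto intro!: compact_continuous_image continuous_intros)
  have "closed cantor_set"
    unfolding cantor_set_def using c by (intro closed_INT) (auto intro: compact_imp_closed)
  moreover have "cantor_set = cantor_step 0 \<inter> cantor_set" unfolding cantor_set_def by blast
  ultimately show ?thesis using compact_Int_closed c by metis
qed

text \<open>Compactness of the Cantor set upgrades continuity of the homeomorphism to uniform
  continuity, which then takes the cylinder form.\<close>

lemma cantor_metric_space_param:
  assumes "cantor_metric_space X"
  obtains \<phi> where "range \<phi> = mspace X"
    "\<And>\<epsilon>. 0 < \<epsilon> \<Longrightarrow> \<exists>n. \<forall>z z'. agree n z z' \<longrightarrow> mdist X (\<phi> z) (\<phi> z') < \<epsilon>"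
proof -
  obtain f g where "homeomorphic_maps (mtopology_of X) (top_of_set cantor_set) f g"
    using assms unfolding cantor_metric_space_def homeomorphic_space_def by blast
  then have f: "continuous_map (mtopology_of X) (top_of_set cantor_set) f"
    and g: "continuous_map (top_of_set cantor_set) (mtopology_of X) g"
    and gf: "\<And>x. x \<in> mspace X \<Longrightarrow> g (f x) = x"
    by (auto simp: homeomorphic_maps_def)
  have f_in: "f x \<in> cantor_set" if "x \<in> mspace X" for x
    using continuous_map_funspace[OF f] that by auto
  have g_in: "g y \<in> mspace X" if "y \<in> cantor_set" for y
    using continuous_map_funspace[OF g] that by auto
  have g_im: "g ` cantor_set = mspace X"
    using f_in g_in gf by force
  let ?C = "submetric euclidean_metric cantor_set"
  have C: "mtopology_of ?C = top_of_set cantor_set"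
    by (simp add: mtopology_of_submetric)
  have "uniformly_continuous_map ?C X g"
    using g compact_cantor_set continuous_eq_uniformly_continuous_map[of ?C X g]
    by (simp add: C compact_space_subtopology)
  then have u: "\<exists>\<delta>>0. \<forall>x\<in>cantor_set. \<forall>y\<in>cantor_set. dist y x < \<delta> \<longrightarrow> mdist X (g y) (g x) < \<epsilon>"
    if "0 < \<epsilon>" for \<epsilon>
    using that unfolding uniformly_continuous_map_def by auto
  show ?thesis
  proof
    show "range (g \<circ> cantor_code) = mspace X"
      using g_im range_cantor_code by (metis image_comp)
    fix \<epsilon> :: real assume "0 < \<epsilon>"
    then obtain \<delta> where \<delta>: "0 < \<delta>"
      "\<And>x y. x \<in> cantor_set \<Longrightarrow> y \<in> cantor_set \<Longrightarrow> dist y x < \<delta> \<Longrightarrow> mdist X (g y) (g x) < \<epsilon>"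
      using u by metis
    obtain n where n: "(1 / 3 :: real) ^ n < \<delta>"
      using real_arch_pow_inv[OF \<delta>(1), of "1 / 3"] by auto
    have "mdist X (g (cantor_code z)) (g (cantor_code z')) < \<epsilon>" if "agree n z z'" for z z'
      using agree_imp_cantor_code_close[OF that] n
      by (intro \<delta>(2)) (auto simp: dist_real_def simp flip: range_cantor_code)
    then show "\<exists>n. \<forall>z z'. agree n z z' \<longrightarrow> mdist X ((g \<circ> cantor_code) z) ((g \<circ> cantor_code) z') < \<epsilon>"
      by auto
  qed
qed

lemma cantor_metric_spaceI:
  fixes m :: "(nat \<Rightarrow> bool) metric"
  assumes "mspace m = UNIV"
    and "\<And>\<epsilon>. 0 < \<epsilon> \<Longrightarrow> \<exists>n. \<forall>z z'. agree n z z' \<longrightarrow> mdist m z z' < \<epsilon>"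
  shows "ne_compact m \<and> cantor_metric_space m"
proof -
  let ?g = "inv cantor_code"
  let ?C = "submetric euclidean_metric cantor_set"
  have C: "mtopology_of ?C = top_of_set cantor_set"
    by (simp add: mtopology_of_submetric)
  have "uniformly_continuous_map ?C m ?g"
    unfolding uniformly_continuous_map_def
  proof (intro conjI allI impI)
    fix \<epsilon> :: real assume "0 < \<epsilon>"
    then obtain n where n: "\<And>z z'. agree n z z' \<Longrightarrow> mdist m z z' < \<epsilon>" using assms(2) by blast
    have "mdist m (?g y) (?g x) < \<epsilon>"
      if "x \<in> cantor_set" "y \<in> cantor_set" "dist y x < (1 / 3) ^ n" for x y
      using that n[OF cantor_code_close_imp_agree[of _ _ n]]
      by (auto simp: dist_real_def cantor_code_inj inv_f_f simp flip: range_cantor_code)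
    then show "\<exists>\<delta>>0. \<forall>x\<in>mspace ?C. \<forall>y\<in>mspace ?C. mdist ?C y x < \<delta> \<longrightarrow> mdist m (?g y) (?g x) < \<epsilon>"
      by (intro exI[of _ "(1 / 3) ^ n"]) auto
  qed (simp add: assms(1))
  then have "continuous_map (top_of_set cantor_set) (mtopology_of m) ?g"
    using uniformly_continuous_imp_continuous_map C by metis
  moreover have "Hausdorff_space (mtopology_of m)"
    by (simp add: Metric_space.Hausdorff_space_mtopology mtopology_of_def)
  moreover have "?g ` cantor_set = UNIV"
    using range_cantor_code cantor_code_inj by (metis image_inv_f_f)
  moreover have "inj_on ?g cantor_set"
    unfolding range_cantor_code[symmetric] by (rule inj_on_inv_into) simp
  ultimately have "homeomorphic_map (top_of_set cantor_set) (mtopology_of m) ?g"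
    using compact_cantor_set assms(1)
    by (intro continuous_imp_homeomorphic_map) (simp_all add: compact_space_subtopology)
  then have h: "top_of_set cantor_set homeomorphic_space mtopology_of m"
    by (rule homeomorphic_map_imp_homeomorphic_space)
  then show ?thesis
    using homeomorphic_compact_space[OF h] compact_cantor_set assms(1) homeomorphic_space_sym
    by (auto simp: ne_compact_def cantor_metric_space_def compact_space_subtopology)
qed

text \<open>\<open>track R z n\<close> is a point of \<open>R\<close> that copies the digits of \<open>z\<close> greedily up to place \<open>n\<close>.\<close>

primrec track :: "(nat \<Rightarrow> bool) set \<Rightarrow> (nat \<Rightarrow> bool) \<Rightarrow> nat \<Rightarrow> nat \<Rightarrow> bool" where
  "track R z 0 = (SOME w. w \<in> R)"
| "track R z (Suc n) =
    (if \<exists>w\<in>R. agree n w (track R z n) \<and> w n = z n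
     then SOME w. w \<in> R \<and> agree n w (track R z n) \<and> w n = z n
     else track R z n)"

text \<open>Nonempty closed sets of binary sequences are retracts of the whole space. Greedy copying
  never fails on a point of \<open>R\<close>, so \<open>r\<close> fixes \<open>R\<close>, and a
  prefix of \<open>r z\<close> depends only on the same prefix of \<open>z\<close>.\<close>

lemma closed_imp_retract:
  assumes "R \<noteq> {}" and closed: "\<And>z. (\<And>n. \<exists>w\<in>R. agree n z w) \<Longrightarrow> z \<in> R"
  obtains r where "range r = R" "\<And>n z z'. agree n z z' \<Longrightarrow> agree n (r z) (r z')"
proof -
  have S: "track R z (Suc n) \<in> R \<and> agree n (track R z (Suc n)) (track R z n) \<and> track R z (Suc n) n = z n"
    if "w \<in> R" "agree n w (track R z n)" "w n = z n" for w z n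
  proof -
    have "\<exists>w. w \<in> R \<and> agree n w (track R z n) \<and> w n = z n" using that by blast
    from someI_ex[OF this] show ?thesis using that by auto
  qed
  have in_R: "track R z n \<in> R" for z n
  proof (induction n)
    case 0
    show ?case using assms(1) by (simp add: some_in_eq)
  next
    case (Suc n)
    show ?case
    proof (cases "\<exists>w\<in>R. agree n w (track R z n) \<and> w n = z n")
      case True
      then show ?thesis using S by blast
    next
      case False
      then have "track R z (Suc n) = track R z n" unfolding track.simps by (rule if_not_P)
      then show ?thesis using Suc by simp
    qed
  qed
  have step: "agree n (track R z (Suc n)) (track R z n)" for z n
  proof (cases "\<exists>w\<in>R. agree n w (track R z n) \<and> w n = z n")
    case True
    then show ?thesis using S by blast
  next
    case False
    then have "track R z (Suc n) = track R z n" unfolding track.simps by (rule if_not_P)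
    then show ?thesis by simp
  qed
  have steps: "agree n (track R z (n + k)) (track R z n)" for z n k
  proof (induction k)
    case (Suc k)
    have "agree n (track R z (n + Suc k)) (track R z (n + k))"
      using agree_mono[OF step[of "n + k" z] le_add1] by simp
    then show ?case using Suc by (rule agree_trans)
  qed simp
  \<comment> \<open>Digit \<open>n\<close> is settled at stage \<open>Suc n\<close> and never
    changes later, so the stages are combined diagonally.\<close>
  define r where "r z n = track R z (Suc n) n" for z n
  have r: "agree n (r z) (track R z n)" for z n
    unfolding agree_def
  proof (intro allI impI)
    fix i assume "i < n"
    then show "r z i = track R z n i"
      using steps[of "Suc i" z "n - Suc i"] by (simp add: r_def agree_def)
  qed
  have eq: "track R z n = track R z' n" if "agree n z z'" for n z z'
    using that by (induction n) (simp_all only: track.simps agree_Suc)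
  have fix_R: "agree n (track R z n) z" if "z \<in> R" for n z
  proof (induction n)
    case 0
    show ?case by (simp add: agree_def)
  next
    case (Suc n)
    have "agree n (track R z (Suc n)) (track R z n)" "track R z (Suc n) n = z n"
      using S[OF that agree_sym[OF Suc] refl] by blast+
    then show ?case using agree_trans[OF _ Suc] unfolding agree_Suc by blast
  qed
  show ?thesis
  proof
    have "r z \<in> R" for z using closed r in_R by blast
    moreover have "r z = z" if "z \<in> R" for z
      using ex_not_agree r fix_R[OF that] agree_trans by metis
    ultimately show "range r = R" by (metis image_subsetI range_eqI subsetI subset_antisym)
    show "agree n (r z) (r z')" if "agree n z z'" for n z z'
      using r[of n z] r[of n z'] eq[OF that] by (metis agree_sym agree_trans)
  qed
qed

text \<open>The sequences whose even and odd halves code a pair at coupling distance at most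
  \<open>D\<close> form a closed set. Composing with a retraction onto it turns an optimal
  correspondence into a pair of maps on the whole space of binary sequences.\<close>

lemma coupling_param:
  assumes X: "cantor_metric_space X" "mspace X \<noteq> {}" and Y: "cantor_metric_space Y"
    and c: "coupling_within X Y D c"
  obtains f g where "range f = mspace X" "range g = mspace Y"
    "\<And>z. c (f z) (g z) \<le> D"
    "\<And>\<epsilon>. 0 < \<epsilon> \<Longrightarrow> \<exists>n. \<forall>z z'. agree n z z' \<longrightarrow> mdist X (f z) (f z') < \<epsilon>"
    "\<And>\<epsilon>. 0 < \<epsilon> \<Longrightarrow> \<exists>n. \<forall>z z'. agree n z z' \<longrightarrow> mdist Y (g z) (g z') < \<epsilon>"
proof -
  obtain \<phi> where \<phi>: "range \<phi> = mspace X"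
    "\<And>\<epsilon>. 0 < \<epsilon> \<Longrightarrow> \<exists>n. \<forall>z z'. agree n z z' \<longrightarrow> mdist X (\<phi> z) (\<phi> z') < \<epsilon>"
    using cantor_metric_space_param[OF X(1)] by blast
  obtain \<psi> where \<psi>: "range \<psi> = mspace Y"
    "\<And>\<epsilon>. 0 < \<epsilon> \<Longrightarrow> \<exists>n. \<forall>z z'. agree n z z' \<longrightarrow> mdist Y (\<psi> z) (\<psi> z') < \<epsilon>"
    using cantor_metric_space_param[OF Y] by blast
  have cc: "coupling X Y c" using c by (simp add: coupling_within_def)
  have in_X: "\<phi> z \<in> mspace X" and in_Y: "\<psi> z \<in> mspace Y" for z using \<phi>(1) \<psi>(1) by blast+
  define ev od :: "(nat \<Rightarrow> bool) \<Rightarrow> nat \<Rightarrow> bool"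
    where "ev = (\<lambda>z n. z (2 * n))" and "od = (\<lambda>z n. z (Suc (2 * n)))"
  have ag: "agree n (ev z) (ev z')" "agree n (od z) (od z')" if "agree (2 * n) z z'" for n z z'
    using that by (auto simp: agree_def ev_def od_def)
  have pair: "\<exists>z. ev z = a \<and> od z = b" for a b
    by (rule exI[of _ "\<lambda>n. if even n then a (n div 2) else b (n div 2)"]) (simp add: ev_def od_def)
  define R where "R = {z. c (\<phi> (ev z)) (\<psi> (od z)) \<le> D}"
  have left: "\<exists>z\<in>R. \<phi> (ev z) = x" if x: "x \<in> mspace X" for x
  proof -
    obtain y where "y \<in> mspace Y" "c x y \<le> D" using c x unfolding coupling_within_def by blast
    moreover obtain a b where "x = \<phi> a" "y = \<psi> b" using x \<phi>(1) \<psi>(1) \<open>y \<in> mspace Y\<close> by blast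
    ultimately show ?thesis using pair[of a b] by (auto simp: R_def)
  qed
  have right: "\<exists>z\<in>R. \<psi> (od z) = y" if y: "y \<in> mspace Y" for y
  proof -
    obtain x where "x \<in> mspace X" "c x y \<le> D" using c y unfolding coupling_within_def by blast
    moreover obtain a b where "x = \<phi> a" "y = \<psi> b" using y \<phi>(1) \<psi>(1) \<open>x \<in> mspace X\<close> by blast
    ultimately show ?thesis using pair[of a b] by (auto simp: R_def)
  qed
  have "R \<noteq> {}" using left X(2) by blast
  moreover have "z \<in> R" if z: "\<And>n. \<exists>w\<in>R. agree n z w" for z
  proof -
    have "c (\<phi> (ev z)) (\<psi> (od z)) \<le> D"
    proof (rule field_le_epsilon)
      fix e :: real assume "0 < e"
      then obtain n m where n: "\<And>z z'. agree n z z' \<Longrightarrow> mdist X (\<phi> z) (\<phi> z') < e / 2"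
        and m: "\<And>z z'. agree m z z' \<Longrightarrow> mdist Y (\<psi> z) (\<psi> z') < e / 2"
        using \<phi>(2)[of "e / 2"] \<psi>(2)[of "e / 2"] by auto
      obtain w where w: "w \<in> R" "agree (2 * (n + m)) z w" using z by blast
      have "mdist X (\<phi> (ev z)) (\<phi> (ev w)) < e / 2"
        by (rule n[OF agree_mono[OF ag(1)[OF w(2)]]]) simp
      moreover have "mdist Y (\<psi> (od w)) (\<psi> (od z)) < e / 2"
        by (rule m[OF agree_mono[OF agree_sym[OF ag(2)[OF w(2)]]]]) simp
      ultimately show "c (\<phi> (ev z)) (\<psi> (od z)) \<le> D + e"
        using couplingD(2)[OF cc in_X[of "ev z"] in_X[of "ev w"] in_Y[of "od z"]]
          couplingD(4)[OF cc in_X[of "ev w"] in_Y[of "od w"] in_Y[of "od z"]] w(1)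
        unfolding R_def mem_Collect_eq by linarith
    qed
    then show ?thesis by (simp add: R_def)
  qed
  ultimately obtain r where r: "range r = R" "\<And>n z z'. agree n z z' \<Longrightarrow> agree n (r z) (r z')"
    using closed_imp_retract[of R] by blast
  show ?thesis
  proof
    have "range (\<lambda>z. \<phi> (ev (r z))) = (\<lambda>z. \<phi> (ev z)) ` R"
      unfolding r(1)[symmetric] by (simp add: image_image)
    also have "\<dots> = mspace X" using left in_X by fast
    finally show "range (\<lambda>z. \<phi> (ev (r z))) = mspace X" .
    have "range (\<lambda>z. \<psi> (od (r z))) = (\<lambda>z. \<psi> (od z)) ` R"
      unfolding r(1)[symmetric] by (simp add: image_image)
    also have "\<dots> = mspace Y" using right in_Y by fast
    finally show "range (\<lambda>z. \<psi> (od (r z))) = mspace Y" .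
    show "c (\<phi> (ev (r z))) (\<psi> (od (r z))) \<le> D" for z
      using r(1) by (auto simp: R_def)
    show "\<exists>n. \<forall>z z'. agree n z z' \<longrightarrow> mdist X (\<phi> (ev (r z))) (\<phi> (ev (r z'))) < \<epsilon>"
      if "0 < \<epsilon>" for \<epsilon>
      using \<phi>(2)[OF that] r(2) ag(1) by meson
    show "\<exists>n. \<forall>z z'. agree n z z' \<longrightarrow> mdist Y (\<psi> (od (r z))) (\<psi> (od (r z'))) < \<epsilon>"
      if "0 < \<epsilon>" for \<epsilon>
      using \<psi>(2)[OF that] r(2) ag(2) by meson
  qed
qed

section \<open>The interpolating metrics\<close>

text \<open>A packing condition. For \<open>n > 0\<close> the equation for \<open>card\<close> also
  forces \<open>S\<close> to be finite.\<close>

definition separated :: "'a metric \<Rightarrow> nat \<Rightarrow> real \<Rightarrow> bool" where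
  "separated m n \<delta> \<longleftrightarrow>
     (\<exists>S\<subseteq>mspace m. card S = n \<and> (\<forall>x\<in>S. \<forall>y\<in>S. x \<noteq> y \<longrightarrow> \<delta> \<le> mdist m x y))"

lemma separated_isometric:
  assumes "isometric X Y" "separated X n \<delta>"
  shows "separated Y n \<delta>"
proof -
  obtain f where f: "isometric_embedding X Y f" using assms(1) unfolding isometric_def by blast
  obtain S where S: "S \<subseteq> mspace X" "card S = n" "\<And>x y. x \<in> S \<Longrightarrow> y \<in> S \<Longrightarrow> x \<noteq> y \<Longrightarrow> \<delta> \<le> mdist X x y"
    using assms(2) unfolding separated_def by blast
  have "card (f ` S) = n"
    using S(1,2) isometric_embedding_inj_on[OF f] by (metis card_image inj_on_subset)
  moreover have "f ` S \<subseteq> mspace Y" using f S(1) unfolding isometric_embedding_def by blast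
  moreover have "\<delta> \<le> mdist Y u v" if uv: "u \<in> f ` S" "v \<in> f ` S" "u \<noteq> v" for u v
  proof -
    obtain x y where xy: "u = f x" "v = f y" "x \<in> S" "y \<in> S" using uv by blast
    then have "x \<in> mspace X" "y \<in> mspace X" using S(1) by blast+
    then have "mdist Y u v = mdist X x y"
      using f xy(1,2) unfolding isometric_embedding_def by simp
    then show ?thesis using S(3)[OF xy(3,4)] uv(3) xy(1,2) by auto
  qed
  ultimately show ?thesis unfolding separated_def by (intro exI[of _ "f ` S"]) simp
qed

definition first_diff :: "(nat \<Rightarrow> bool) \<Rightarrow> (nat \<Rightarrow> bool) \<Rightarrow> nat" where
  "first_diff z z' = (LEAST n. z n \<noteq> z' n)"

lemma first_diff_sym: "first_diff z z' = first_diff z' z"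
  unfolding first_diff_def by (rule arg_cong[where f = Least]) auto

lemma first_diff_neq: "z \<noteq> z' \<Longrightarrow> z (first_diff z z') \<noteq> z' (first_diff z z')"
  unfolding first_diff_def by (rule LeastI_ex[of "\<lambda>n. z n \<noteq> z' n"]) (auto simp: fun_eq_iff)

lemma first_diff_le: "z n \<noteq> z' n \<Longrightarrow> first_diff z z' \<le> n"
  unfolding first_diff_def by (rule Least_le[of "\<lambda>n. z n \<noteq> z' n"])

lemma agree_first_diff: "agree n z z' \<Longrightarrow> z \<noteq> z' \<Longrightarrow> n \<le> first_diff z z'"
  using first_diff_neq[of z z'] by (auto simp: agree_def simp flip: not_less)

text \<open>The strong triangle inequality at the level of indices: where \<open>z\<close> and
  \<open>z''\<close> first differ, \<open>z'\<close> differs from one of them.\<close>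

lemma min_first_diff_le:
  assumes "z \<noteq> z''"
  shows "z \<noteq> z' \<and> first_diff z z' \<le> first_diff z z'' \<or> z' \<noteq> z'' \<and> first_diff z' z'' \<le> first_diff z z''"
proof (cases "z (first_diff z z'') = z' (first_diff z z'')")
  case True
  then have "z' (first_diff z z'') \<noteq> z'' (first_diff z z'')"
    using first_diff_neq[OF assms] by simp
  then show ?thesis using first_diff_le[of z' "first_diff z z''" z''] by auto
next
  case False
  then show ?thesis using first_diff_le[of z "first_diff z z''" z'] by auto
qed

text \<open>
  \<open>d\<close> and \<open>e\<close> are the metrics of the two given spaces, pulled back along the two coordinates of an
  optimal correspondence parametrised by the Cantor space \<open>{0,1}\<^sup>\<nat>\<close>. The metric \<open>\<rho> s q\<close> is the
  maximum of their linear interpolation and an ultrametric whose value \<open>w k s q\<close> at points first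
  differing in place \<open>k\<close> records the coordinate of \<open>q\<close> with index \<open>fst (prod_decode k)\<close>, so that every
  coordinate is recorded at arbitrarily small scales.
\<close>

locale interpolation =
  fixes d e :: "(nat \<Rightarrow> bool) \<Rightarrow> (nat \<Rightarrow> bool) \<Rightarrow> real" and D :: real
    and c \<epsilon> :: "nat \<Rightarrow> real" and A :: "real set"
  assumes d_nonneg: "0 \<le> d z z'" and d_refl: "d z z = 0" and d_sym: "d z z' = d z' z"
    and d_triangle: "d z z'' \<le> d z z' + d z' z''"
    and e_nonneg: "0 \<le> e z z'" and e_refl: "e z z = 0" and e_sym: "e z z' = e z' z"
    and e_triangle: "e z z'' \<le> e z z' + e z' z''"
    and distortion: "\<bar>d z z' - e z z'\<bar> \<le> 2 * D"
    and agree_d: "agree k z z' \<Longrightarrow> d z z' \<le> \<epsilon> k" and agree_e: "agree k z z' \<Longrightarrow> e z z' \<le> \<epsilon> k"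
    and \<epsilon>_lim: "\<epsilon> \<longlonglongrightarrow> 0"
    and c_pos: "0 < c k" and c_decr: "c (Suc k) < c k" and c_0: "c 0 \<le> D" and c_lim: "c \<longlonglongrightarrow> 0"
    and \<epsilon>_c: "0 < t \<Longrightarrow> \<forall>\<^sub>F k in sequentially. \<epsilon> k \<le> t * c (Suc k)"
    and A: "closed A" "A \<subseteq> {0..1}" "{0, 1} \<subseteq> A"
begin

text \<open>
  \<open>w k s q\<close> equals \<open>(m - a) * c k + a * u\<close> with \<open>m = min s (1 - s)\<close>, \<open>a = infdist s A\<close> and
  \<open>u\<close> the point of \<open>[c (Suc k), c k]\<close> with parameter \<open>q i\<close>; this keeps \<open>w\<close> antitone in \<open>k\<close>.
\<close>

definition w :: "nat \<Rightarrow> real \<Rightarrow> (nat \<Rightarrow> real) \<Rightarrow> real" where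
  "w k s q = min s (1 - s) * c k - infdist s A * ((c k - c (Suc k)) * (1 - q (fst (prod_decode k))))"

definition ult :: "real \<Rightarrow> (nat \<Rightarrow> real) \<Rightarrow> (nat \<Rightarrow> bool) \<Rightarrow> (nat \<Rightarrow> bool) \<Rightarrow> real" where
  "ult s q z z' = (if z = z' then 0 else w (first_diff z z') s q)"

definition base :: "real \<Rightarrow> (nat \<Rightarrow> bool) \<Rightarrow> (nat \<Rightarrow> bool) \<Rightarrow> real" where
  "base s z z' = (1 - s) * d z z' + s * e z z'"

definition \<rho> :: "real \<Rightarrow> (nat \<Rightarrow> real) \<Rightarrow> (nat \<Rightarrow> bool) \<Rightarrow> (nat \<Rightarrow> bool) \<Rightarrow> real" where
  "\<rho> s q z z' = max (base s z z') (ult s q z z')"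

section \<open>Estimates for the ultrametric and the interpolated metric\<close>

lemma D_pos: "0 < D"
  using c_pos[of 0] c_0 by linarith

lemma c_antimono: "k \<le> l \<Longrightarrow> c l \<le> c k"
  using lift_Suc_antimono_le[of c k l] c_decr by (simp add: less_imp_le)

lemma c_le_D: "c k \<le> D"
  using c_antimono[of 0 k] c_0 by simp

lemma infdist_A_le: "infdist s A \<le> min s (1 - s)" if "s \<in> {0..1}"
proof -
  have "infdist s A \<le> dist s 0" by (rule infdist_le) (use A(3) in simp)
  moreover have "infdist s A \<le> dist s 1" by (rule infdist_le) (use A(3) in simp)
  ultimately show ?thesis using that by (auto simp: dist_real_def)
qed

lemma gap:
  assumes "q \<in> UNIV \<rightarrow> {0..1}"
  shows "0 \<le> (c k - c (Suc k)) * (1 - q i)" "(c k - c (Suc k)) * (1 - q i) \<le> c k - c (Suc k)"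
proof -
  have "q i \<in> {0..1}" using assms by blast
  then show "0 \<le> (c k - c (Suc k)) * (1 - q i)" "(c k - c (Suc k)) * (1 - q i) \<le> c k - c (Suc k)"
    using c_decr[of k] by (auto simp: mult_le_cancel_left1)
qed

text \<open>The value at level \<open>k\<close> stays between consecutive terms of \<open>c\<close>,
  scaled by \<open>min s (1 - s)\<close>. Neighbouring intervals meet in an endpoint, so
  monotonicity in \<open>k\<close> survives any choice of \<open>q\<close>.\<close>

lemma w_bounds:
  assumes s: "s \<in> {0..1}" and q: "q \<in> UNIV \<rightarrow> {0..1}"
  shows "min s (1 - s) * c (Suc k) \<le> w k s q" "w k s q \<le> min s (1 - s) * c k"
proof -
  let ?g = "(c k - c (Suc k)) * (1 - q (fst (prod_decode k)))"
  have "infdist s A * ?g \<le> min s (1 - s) * (c k - c (Suc k))"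
    by (rule mult_mono[OF infdist_A_le[OF s] gap(2)[OF q] _ gap(1)[OF q]]) (use s in auto)
  then show "min s (1 - s) * c (Suc k) \<le> w k s q"
    unfolding w_def by (simp add: right_diff_distrib)
  have "0 \<le> infdist s A * ?g" by (rule mult_nonneg_nonneg[OF infdist_nonneg gap(1)[OF q]])
  then show "w k s q \<le> min s (1 - s) * c k" unfolding w_def by linarith
qed

lemma w_nonneg:
  assumes "s \<in> {0..1}" "q \<in> UNIV \<rightarrow> {0..1}"
  shows "0 \<le> w k s q"
proof (rule order_trans[OF _ w_bounds(1)[OF assms]])
  show "0 \<le> min s (1 - s) * c (Suc k)"
    using assms(1) c_pos[of "Suc k"] by (intro mult_nonneg_nonneg) auto
qed

lemma w_pos:
  assumes "s \<in> {0<..<1}" "q \<in> UNIV \<rightarrow> {0..1}"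
  shows "0 < w k s q"
proof (rule less_le_trans[OF _ w_bounds(1)[OF _ assms(2)]])
  show "0 < min s (1 - s) * c (Suc k)"
    using assms(1) c_pos[of "Suc k"] by (intro mult_pos_pos) auto
qed (use assms(1) in simp)

lemma w_antimono:
  assumes "s \<in> {0..1}" "q \<in> UNIV \<rightarrow> {0..1}" "k \<le> l"
  shows "w l s q \<le> w k s q"
  using assms(3)
proof (rule lift_Suc_antimono_le[rotated])
  show "w (Suc n) s q \<le> w n s q" for n
    using w_bounds[OF assms(1,2)] order_trans by blast
qed

text \<open>Both \<open>min s (1 - s)\<close> and \<open>infdist s A\<close> are 1-Lipschitz in
  \<open>s\<close> and come with factors between 0 and \<open>D\<close>. The assumption
  \<open>c 0 \<le> D\<close> is made for this constant, which matches the one for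
  \<open>base\<close>.\<close>

lemma w_lipschitz:
  assumes q: "q \<in> UNIV \<rightarrow> {0..1}"
  shows "\<bar>w k s q - w k t q\<bar> \<le> 2 * D * \<bar>s - t\<bar>"
proof -
  let ?g = "(c k - c (Suc k)) * (1 - q (fst (prod_decode k)))"
  have "\<bar>infdist s A - infdist t A\<bar> \<le> \<bar>s - t\<bar>"
    using infdist_triangle[of s A t] infdist_triangle[of t A s] by (auto simp: dist_real_def abs_le_iff)
  moreover have g: "0 \<le> ?g" "?g \<le> D"
    using gap[OF q] c_le_D[of k] c_pos[of "Suc k"] by (smt (verit))+
  ultimately have 1: "\<bar>(infdist s A - infdist t A) * ?g\<bar> \<le> \<bar>s - t\<bar> * D"
    unfolding abs_mult by (intro mult_mono) auto
  have "\<bar>min s (1 - s) - min t (1 - t)\<bar> \<le> \<bar>s - t\<bar>" by linarith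
  then have 2: "\<bar>(min s (1 - s) - min t (1 - t)) * c k\<bar> \<le> \<bar>s - t\<bar> * D"
    unfolding abs_mult using c_le_D[of k] c_pos[of k] by (intro mult_mono) auto
  have "w k s q - w k t q = (min s (1 - s) - min t (1 - t)) * c k - (infdist s A - infdist t A) * ?g"
    unfolding w_def by (simp add: left_diff_distrib)
  also have "\<bar>\<dots>\<bar> \<le> \<bar>(min s (1 - s) - min t (1 - t)) * c k\<bar> + \<bar>(infdist s A - infdist t A) * ?g\<bar>"
    by (rule abs_triangle_ineq4)
  also have "\<dots> \<le> \<bar>s - t\<bar> * D + \<bar>s - t\<bar> * D"
    using 2 1 by (rule add_mono)
  finally show ?thesis by (simp add: mult_ac)
qed

lemma w_diff:
  assumes "s \<in> {0..1}"
  shows "\<bar>w k s q - w k s r\<bar> \<le> c k * \<bar>q (fst (prod_decode k)) - r (fst (prod_decode k))\<bar>"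
proof -
  let ?i = "fst (prod_decode k)"
  have "infdist s A \<le> 1" using infdist_A_le[OF assms] assms by auto
  moreover have "0 \<le> c k - c (Suc k)" "c k - c (Suc k) \<le> c k"
    using c_decr[of k] c_pos[of "Suc k"] by auto
  ultimately have "infdist s A * (c k - c (Suc k)) * \<bar>q ?i - r ?i\<bar> \<le> 1 * c k * \<bar>q ?i - r ?i\<bar>"
    by (intro mult_right_mono mult_mono) (auto simp: infdist_nonneg)
  moreover have "w k s q - w k s r = infdist s A * (c k - c (Suc k)) * (q ?i - r ?i)"
    unfolding w_def by (simp add: algebra_simps)
  ultimately show ?thesis
    using \<open>0 \<le> c k - c (Suc k)\<close> by (simp add: abs_mult infdist_nonneg)
qed

lemma ult_triangle:
  assumes "s \<in> {0..1}" "q \<in> UNIV \<rightarrow> {0..1}"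
  shows "ult s q z z'' \<le> max (ult s q z z') (ult s q z' z'')"
proof (cases "z = z''")
  case True
  then show ?thesis using w_nonneg[OF assms] by (auto simp: ult_def le_max_iff_disj)
next
  case False
  then show ?thesis
    using min_first_diff_le[OF False, of z'] w_antimono[OF assms] unfolding ult_def
    by (auto simp: le_max_iff_disj)
qed

lemma base_triangle:
  assumes "s \<in> {0..1}"
  shows "base s z z'' \<le> base s z z' + base s z' z''"
proof -
  have "(1 - s) * d z z'' \<le> (1 - s) * (d z z' + d z' z'')"
    using assms by (intro mult_left_mono d_triangle) simp
  moreover have "s * e z z'' \<le> s * (e z z' + e z' z'')"
    using assms by (intro mult_left_mono e_triangle) simp
  ultimately show ?thesis unfolding base_def distrib_left by linarith
qed

lemma base_nonneg: "s \<in> {0..1} \<Longrightarrow> 0 \<le> base s z z'"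
  unfolding base_def by (intro add_nonneg_nonneg mult_nonneg_nonneg d_nonneg e_nonneg) auto

lemma \<rho>_nonneg: "s \<in> {0..1} \<Longrightarrow> 0 \<le> \<rho> s q z z'"
  unfolding \<rho>_def using base_nonneg[of s z z'] by (simp add: le_max_iff_disj)

text \<open>The pulled-back metrics may vanish at distinct sequences; for \<open>s\<close> strictly
  between 0 and 1 the ultrametric separates them. The maximum keeps the triangle inequality.\<close>

lemma Metric_space_\<rho>:
  assumes s: "s \<in> {0<..<1}" and q: "q \<in> UNIV \<rightarrow> {0..1}"
  shows "Metric_space UNIV (\<rho> s q)"
proof
  have s': "s \<in> {0..1}" using s by simp
  fix z z' z''
  show "0 \<le> \<rho> s q z z'" using \<rho>_nonneg[OF s'] .
  show "\<rho> s q z z' = \<rho> s q z' z"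
    by (simp add: \<rho>_def base_def ult_def first_diff_sym d_sym[of z z'] e_sym[of z z'])
  show "\<rho> s q z z' = 0 \<longleftrightarrow> z = z'"
  proof
    show "\<rho> s q z z' = 0" if "z = z'"
      using that by (simp add: \<rho>_def base_def ult_def d_refl e_refl)
    show "z = z'" if "\<rho> s q z z' = 0"
      using that w_pos[OF s q, of "first_diff z z'"] by (auto simp: \<rho>_def ult_def split: if_splits)
  qed
  show "\<rho> s q z z'' \<le> \<rho> s q z z' + \<rho> s q z' z''"
    using base_triangle[OF s', of z z'' z'] ult_triangle[OF s' q, of z z'' z']
      \<rho>_nonneg[OF s', of q z z'] \<rho>_nonneg[OF s', of q z' z'']
    unfolding \<rho>_def by linarith
qed

text \<open>The interpolation moves at speed at most the distortion bound \<open>2 * D\<close>, the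
  ultrametric at the same speed, and a maximum preserves the bound. Halved, it becomes the speed
  \<open>D\<close> of a geodesic.\<close>

lemma \<rho>_lipschitz:
  assumes q: "q \<in> UNIV \<rightarrow> {0..1}"
  shows "\<bar>\<rho> s q z z' - \<rho> t q z z'\<bar> \<le> 2 * D * \<bar>s - t\<bar>"
proof -
  have "base s z z' - base t z z' = (s - t) * (e z z' - d z z')"
    unfolding base_def by (simp add: algebra_simps)
  moreover have "\<bar>(s - t) * (e z z' - d z z')\<bar> \<le> \<bar>s - t\<bar> * (2 * D)"
    unfolding abs_mult using distortion[of z z'] by (intro mult_left_mono) auto
  ultimately have "\<bar>base s z z' - base t z z'\<bar> \<le> 2 * D * \<bar>s - t\<bar>"
    by (simp add: mult.commute)
  moreover have "\<bar>ult s q z z' - ult t q z z'\<bar> \<le> 2 * D * \<bar>s - t\<bar>"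
    unfolding ult_def using w_lipschitz[OF q] D_pos by simp
  ultimately show ?thesis unfolding \<rho>_def by linarith
qed

lemma ult_boundary:
  assumes "s = 0 \<or> s = 1" "q \<in> UNIV \<rightarrow> {0..1}"
  shows "ult s q z z' = 0"
proof -
  have "w (first_diff z z') s q = 0"
    using w_bounds[OF _ assms(2), of s "first_diff z z'"] assms(1) by auto
  then show ?thesis by (simp add: ult_def)
qed

lemma \<rho>_0: "q \<in> UNIV \<rightarrow> {0..1} \<Longrightarrow> \<rho> 0 q z z' = d z z'"
  using ult_boundary[of 0 q z z'] d_nonneg[of z z'] by (simp add: \<rho>_def base_def)

lemma \<rho>_1: "q \<in> UNIV \<rightarrow> {0..1} \<Longrightarrow> \<rho> 1 q z z' = e z z'"
  using ult_boundary[of 1 q z z'] e_nonneg[of z z'] by (simp add: \<rho>_def base_def)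

lemma \<rho>_diff:
  assumes "\<And>k. \<bar>w k s q - w k s r\<bar> \<le> \<eta>"
  shows "\<bar>\<rho> s q z z' - \<rho> s r z z'\<bar> \<le> \<eta>"
proof -
  have "0 \<le> \<eta>" using assms[of 0] by linarith
  then have "\<bar>ult s q z z' - ult s r z z'\<bar> \<le> \<eta>"
    using assms[of "first_diff z z'"] by (simp add: ult_def)
  then show ?thesis unfolding \<rho>_def by linarith
qed

section \<open>The interpolating spaces and the recovery of the parameter\<close>

lemma base_agree:
  assumes "s \<in> {0..1}" "agree k z z'"
  shows "base s z z' \<le> \<epsilon> k"
proof -
  have "base s z z' \<le> (1 - s) * \<epsilon> k + s * \<epsilon> k"
    unfolding base_def using assms agree_d agree_e by (intro add_mono mult_left_mono) auto
  then show ?thesis by (simp add: algebra_simps)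
qed

lemma ult_agree:
  assumes "s \<in> {0..1}" "q \<in> UNIV \<rightarrow> {0..1}" "agree k z z'"
  shows "ult s q z z' \<le> w k s q"
proof (cases "z = z'")
  case True
  then show ?thesis using w_nonneg[OF assms(1,2)] by (simp add: ult_def)
next
  case False
  then show ?thesis
    using w_antimono[OF assms(1,2) agree_first_diff[OF assms(3) False]] by (simp add: ult_def)
qed

text \<open>Carrier and distance are as expected for \<open>0 < s < 1\<close>; at the ends
  \<open>\<rho>\<close> can be a mere pseudometric, so \<open>bunch\<close> inserts \<open>X\<close>
  and \<open>Y\<close> there.\<close>

definition M :: "real \<Rightarrow> (nat \<Rightarrow> real) \<Rightarrow> (nat \<Rightarrow> bool) metric" where
  "M s q = metric (UNIV, \<rho> s q)"

text \<open>On \<open>A\<close> the amplitude \<open>infdist s A\<close> is 0, which erases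
  \<open>q\<close>.\<close>

lemma M_cong:
  assumes "s \<in> A"
  shows "M s q = M s r"
proof -
  have "w k s q = w k s r" for k using assms by (simp add: w_def)
  then have "\<rho> s q = \<rho> s r" by (intro ext) (simp add: \<rho>_def ult_def)
  then show ?thesis by (simp add: M_def)
qed

lemma mspace_M: "s \<in> {0<..<1} \<Longrightarrow> q \<in> UNIV \<rightarrow> {0..1} \<Longrightarrow> mspace (M s q) = UNIV"
  unfolding M_def using Metric_space.mspace_metric[OF Metric_space_\<rho>] .

lemma mdist_M: "s \<in> {0<..<1} \<Longrightarrow> q \<in> UNIV \<rightarrow> {0..1} \<Longrightarrow> mdist (M s q) = \<rho> s q"
  unfolding M_def using Metric_space.mdist_metric[OF Metric_space_\<rho>] .

lemma M_cantor:
  assumes s: "s \<in> {0<..<1}" and q: "q \<in> UNIV \<rightarrow> {0..1}"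
  shows "ne_compact (M s q) \<and> cantor_metric_space (M s q)"
proof (rule cantor_metric_spaceI)
  fix r :: real assume "0 < r"
  have s': "s \<in> {0..1}" using s by simp
  have "\<forall>\<^sub>F k in sequentially. \<epsilon> k < r \<and> c k < r"
    using order_tendstoD(2)[OF \<epsilon>_lim \<open>0 < r\<close>] order_tendstoD(2)[OF c_lim \<open>0 < r\<close>]
    by (rule eventually_conj)
  then obtain k where k: "\<epsilon> k < r" "c k < r"
    using eventually_happens'[OF sequentially_bot] by blast
  have "w k s q \<le> min s (1 - s) * c k" by (rule w_bounds(2)[OF s' q])
  also have "\<dots> \<le> 1 * c k" using s c_pos[of k] by (intro mult_right_mono) auto
  finally have "w k s q < r" using k by simp
  then have "\<rho> s q z z' < r" if "agree k z z'" for z z'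
    using base_agree[OF s' that] ult_agree[OF s' q that] k(1) by (simp add: \<rho>_def)
  then show "\<exists>n. \<forall>z z'. agree n z z' \<longrightarrow> mdist (M s q) z z' < r"
    by (auto simp: mdist_M[OF s q])
qed (rule mspace_M[OF s q])

lemma separated_M_w:
  assumes s: "s \<in> {0<..<1}" and q: "q \<in> UNIV \<rightarrow> {0..1}"
  shows "separated (M s q) (2 ^ Suc k) (w k s q)"
  unfolding separated_def
proof (intro exI conjI ballI impI)
  \<comment> \<open>One sequence for each pattern of the places up to \<open>k\<close>, continued by
    \<open>False\<close>; two such sequences first differ at place \<open>k\<close> or
    earlier.\<close>
  let ?S = "(\<lambda>T n. n \<in> T) ` Pow {..<Suc k}"
  have "inj_on (\<lambda>T n. n \<in> T) (Pow {..<Suc k})" by (rule inj_onI) (metis subsetI subset_antisym)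
  then show "card ?S = 2 ^ Suc k" by (simp add: card_image card_Pow)
  show "?S \<subseteq> mspace (M s q)" using mspace_M[OF s q] by simp
  fix z z' assume z: "z \<in> ?S" "z' \<in> ?S" "z \<noteq> z'"
  have "first_diff z z' \<le> k"
    using z first_diff_neq[OF z(3)] by (auto simp: less_Suc_eq_le)
  then have "w k s q \<le> ult s q z z'"
    using z(3) w_antimono[OF _ q] s by (simp add: ult_def)
  then show "w k s q \<le> mdist (M s q) z z'"
    by (simp add: mdist_M[OF s q] \<rho>_def)
qed

text \<open>There are \<open>2 ^ k\<close> cylinders of length \<open>k\<close>, so two of the
  \<open>2 ^ Suc k\<close> points share one. Within it the interpolated distance is at most
  \<open>\<epsilon> k\<close>, hence at most the lower bound
  \<open>min s (1 - s) * c (Suc k)\<close> of \<open>w k s q\<close>, and the ultrametric is at most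
  \<open>w k s q\<close>.\<close>

lemma separated_M_imp_le:
  assumes s: "s \<in> {0<..<1}" and q: "q \<in> UNIV \<rightarrow> {0..1}"
    and k: "\<epsilon> k \<le> min s (1 - s) * c (Suc k)" and sep: "separated (M s q) (2 ^ Suc k) \<delta>"
  shows "\<delta> \<le> w k s q"
proof -
  have s': "s \<in> {0..1}" using s by simp
  obtain S where S: "card S = 2 ^ Suc k" "\<And>x y. x \<in> S \<Longrightarrow> y \<in> S \<Longrightarrow> x \<noteq> y \<Longrightarrow> \<delta> \<le> \<rho> s q x y"
    using sep unfolding separated_def mdist_M[OF s q] by blast
  let ?f = "\<lambda>z. {i. i < k \<and> z i}"
  have "?f ` S \<subseteq> Pow {..<k}" by auto
  then have "card (?f ` S) \<le> 2 ^ k"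
    by (metis card_Pow card_lessThan card_mono finite_Pow_iff finite_lessThan)
  then have "card (?f ` S) < card S" unfolding S(1) by (simp add: le_less_trans)
  then obtain z z' where z: "z \<in> S" "z' \<in> S" "z \<noteq> z'" "?f z = ?f z'"
    using pigeonhole[of ?f S] unfolding inj_on_def by blast
  then have "agree k z z'" by (auto simp: agree_def)
  then have "\<rho> s q z z' \<le> w k s q"
    using base_agree[OF s', of k z z'] ult_agree[OF s' q, of k z z'] k w_bounds(1)[OF s' q, of k]
    unfolding \<rho>_def by linarith
  then show ?thesis using S(2)[OF z(1-3)] by linarith
qed

text \<open>At every sufficiently small scale \<open>w k s q\<close> is the largest separation of
  \<open>2 ^ Suc k\<close> points and thus an isometry invariant.\<close>

lemma isometric_M_imp_eq:
  assumes s: "s \<in> {0<..<1} - A" and q: "q \<in> UNIV \<rightarrow> {0..1}" and r: "r \<in> UNIV \<rightarrow> {0..1}"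
    and iso: "isometric (M s q) (M s r)"
  shows "q = r"
proof
  fix i
  have s': "s \<in> {0<..<1}" using s by simp
  have "0 < min s (1 - s)" using s by auto
  from \<epsilon>_c[OF this] obtain N where N: "\<And>k. N \<le> k \<Longrightarrow> \<epsilon> k \<le> min s (1 - s) * c (Suc k)"
    unfolding eventually_sequentially by blast
  \<comment> \<open>This index records coordinate \<open>i\<close> and is at least \<open>N\<close>,
    so the scale is small enough.\<close>
  define k where "k = prod_encode (i, N)"
  have k: "\<epsilon> k \<le> min s (1 - s) * c (Suc k)"
    by (rule N) (simp add: k_def le_prod_encode_2)
  have "w k s q \<le> w k s r"
    by (rule separated_M_imp_le[OF s' r k separated_isometric[OF iso separated_M_w[OF s' q]]])
  moreover have "w k s r \<le> w k s q"
    by (rule separated_M_imp_le[OF s' q k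
          separated_isometric[OF isometric_sym[OF iso] separated_M_w[OF s' r]]])
  ultimately have "w k s q = w k s r" by simp
  \<comment> \<open>Since \<open>A\<close> is closed and misses \<open>s\<close>, the amplitude is
    nonzero and the coordinate can be solved for.\<close>
  moreover have "infdist s A \<noteq> 0"
    using in_closed_iff_infdist_zero[of A s] A s by auto
  ultimately show "q i = r i"
    using c_decr[of k] by (simp add: w_def k_def)
qed

end

section \<open>The branching bunch\<close>

lemma agree_modulus:
  fixes h :: "(nat \<Rightarrow> bool) \<Rightarrow> (nat \<Rightarrow> bool) \<Rightarrow> real"
  assumes nonneg: "\<And>z z'. 0 \<le> h z z'" and bound: "\<And>z z'. h z z' \<le> B"
    and unif: "\<And>r. 0 < r \<Longrightarrow> \<exists>n. \<forall>z z'. agree n z z' \<longrightarrow> h z z' < r"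
  obtains \<epsilon> where "\<And>k. 0 \<le> \<epsilon> k" "\<And>k. \<epsilon> (Suc k) \<le> \<epsilon> k" "\<epsilon> \<longlonglongrightarrow> 0"
    "\<And>k z z'. agree k z z' \<Longrightarrow> h z z' \<le> \<epsilon> k"
proof -
  define P where "P k = {p. agree k (fst p) (snd p)}" for k
  \<comment> \<open>The supremum of \<open>h\<close> over pairs in a common cylinder; uniform
    continuity makes it a null sequence.\<close>
  define \<epsilon> where "\<epsilon> k = (SUP p\<in>P k. h (fst p) (snd p))" for k
  have bdd: "bdd_above ((\<lambda>p. h (fst p) (snd p)) ` P k)" for k
    by (rule bdd_aboveI2[of _ _ B]) (rule bound)
  have ne: "P k \<noteq> {}" for k
  proof -
    have "(undefined, undefined) \<in> P k" by (simp add: P_def)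
    then show ?thesis by blast
  qed
  have le: "h z z' \<le> \<epsilon> k" if "agree k z z'" for k z z'
    using cSUP_upper[OF _ bdd, of "(z, z')" k] that by (simp add: P_def \<epsilon>_def)
  have nn: "0 \<le> \<epsilon> k" for k
    using order_trans[OF nonneg le[OF agree_refl]] .
  have anti: "\<epsilon> l \<le> \<epsilon> k" if "k \<le> l" for k l
    unfolding \<epsilon>_def by (rule cSUP_subset_mono[OF ne bdd]) (auto simp: P_def intro: agree_mono[OF _ that])
  have "\<epsilon> \<longlonglongrightarrow> 0"
  proof (rule order_tendstoI)
    show "\<forall>\<^sub>F k in sequentially. a < \<epsilon> k" if "a < 0" for a
      using nn that by (intro always_eventually) (metis less_le_trans)
    show "\<forall>\<^sub>F k in sequentially. \<epsilon> k < a" if a: "0 < a" for a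
    proof -
      obtain n where n: "\<And>z z'. agree n z z' \<Longrightarrow> h z z' < a / 2" using unif[OF half_gt_zero[OF a]] by blast
      have "\<epsilon> n \<le> a / 2"
        unfolding \<epsilon>_def
      proof (rule cSUP_least[OF ne])
        show "h (fst p) (snd p) \<le> a / 2" if "p \<in> P n" for p
          using n[of "fst p" "snd p"] that by (simp add: P_def)
      qed
      then have "\<epsilon> k < a" if "n \<le> k" for k using anti[OF that] a by linarith
      then show ?thesis unfolding eventually_sequentially by blast
    qed
  qed
  then show ?thesis using that[of \<epsilon>] nn anti le by simp
qed

text \<open>Taking \<open>c\<close> of the order of \<open>\<surd>\<epsilon>\<close> makes \<open>c\<close> dominate \<open>\<epsilon>\<close> by any factor.\<close>

lemma dominating_null_sequence:
  fixes \<epsilon> :: "nat \<Rightarrow> real"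
  assumes "\<And>k. 0 \<le> \<epsilon> k" "\<And>k. \<epsilon> (Suc k) \<le> \<epsilon> k" "\<epsilon> \<longlonglongrightarrow> 0" "0 < D"
  obtains c where "\<And>k. 0 < c k" "\<And>k. c (Suc k) < c k" "c 0 \<le> D" "c \<longlonglongrightarrow> 0"
    "\<And>t. 0 < t \<Longrightarrow> \<forall>\<^sub>F k in sequentially. \<epsilon> k \<le> t * c (Suc k)"
proof -
  \<comment> \<open>The denominator exceeds \<open>sqrt (\<epsilon> 0) + 1\<close>, so that
    \<open>b 0 < D\<close>.\<close>
  define \<eta> where "\<eta> = D / (sqrt (\<epsilon> 0) + 2)"
  have den: "0 < sqrt (\<epsilon> 0) + 2" using real_sqrt_ge_zero[OF assms(1)[of 0]] by linarith
  have \<eta>: "0 < \<eta>" unfolding \<eta>_def using den assms(4) by simp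
  \<comment> \<open>The geometric term keeps \<open>b\<close> positive and strictly decreasing even
    where \<open>\<epsilon>\<close> is constant or zero.\<close>
  define b where "b k = \<eta> * (sqrt (\<epsilon> k) + (1 / 2) ^ k)" for k
  \<comment> \<open>Prefixing \<open>D\<close> shifts the index: \<open>c (Suc k)\<close> is
    \<open>b k\<close>, which is compared with \<open>\<epsilon> k\<close> of the same
    index.\<close>
  define c where "c = case_nat D b"
  have sq: "(\<lambda>k. sqrt (\<epsilon> k)) \<longlonglongrightarrow> 0" using tendsto_real_sqrt[OF assms(3)] by simp
  have "b \<longlonglongrightarrow> \<eta> * (0 + 0)"
    unfolding b_def by (intro tendsto_intros sq LIMSEQ_realpow_zero) auto
  then have "(\<lambda>k. c (Suc k)) \<longlonglongrightarrow> 0" by (simp add: c_def)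
  then have lim: "c \<longlonglongrightarrow> 0" by (rule LIMSEQ_imp_Suc)
  have b_pos: "0 < b k" for k
    unfolding b_def using \<eta> assms(1)[of k] by (intro mult_pos_pos add_nonneg_pos) auto
  have "b 0 < D"
  proof -
    have "b 0 < \<eta> * (sqrt (\<epsilon> 0) + 2)" unfolding b_def using \<eta> by simp
    also have "\<dots> = D" unfolding \<eta>_def using den by simp
    finally show ?thesis .
  qed
  moreover have "b (Suc k) < b k" for k
    unfolding b_def using \<eta> assms(2)[of k]
    by (intro mult_strict_left_mono add_le_less_mono) auto
  ultimately have decr: "c (Suc k) < c k" for k by (cases k) (simp_all add: c_def)
  have dom: "\<forall>\<^sub>F k in sequentially. \<epsilon> k \<le> t * c (Suc k)" if t: "0 < t" for t
  proof -
    have "\<forall>\<^sub>F k in sequentially. sqrt (\<epsilon> k) < t * \<eta>"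
      using order_tendstoD(2)[OF sq, of "t * \<eta>"] t \<eta> by simp
    then show ?thesis
    proof eventually_elim
      case (elim k)
      have "\<epsilon> k = sqrt (\<epsilon> k) * sqrt (\<epsilon> k)" using assms(1) by simp
      also have "\<dots> \<le> t * \<eta> * sqrt (\<epsilon> k)"
        using elim assms(1)[of k] by (intro mult_right_mono) auto
      also have "\<dots> \<le> t * c (Suc k)"
        using t \<eta> by (simp add: c_def b_def algebra_simps)
      finally show ?case .
    qed
  qed
  show ?thesis
  proof (rule that[OF _ decr _ lim dom])
    show "0 < c k" for k using b_pos assms(4) by (cases k) (simp_all add: c_def)
    show "c 0 \<le> D" by (simp add: c_def)
  qed
qed

section \<open>The Hilbert cube and the case of equal ends\<close>

lemma topspace_hilbert_cube: "topspace hilbert_cube = (UNIV \<rightarrow> {0..1})"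
  by (simp add: hilbert_cube_def PiE_UNIV_domain)

interpretation GH: Metric_space UNIV gh_dist
  by (rule Metric_space_gh_dist)

text \<open>With \<open>A\<close> all of \<open>[0,1]\<close> the injectivity clause is vacuous, so
  equal ends admit the constant map.\<close>

lemma branching_bunch_const:
  assumes "X \<in> CA"
  shows "branching_bunch {0..1} X X (\<lambda>_. X)"
  unfolding branching_bunch_def geodesic_def by auto

lemma openin_hilbert_cube_cylinder:
  assumes "q \<in> topspace hilbert_cube"
  shows "openin hilbert_cube {r \<in> topspace hilbert_cube. \<forall>i<N. \<bar>q i - r i\<bar> < \<delta>}"
proof -
  have "openin hilbert_cube {r \<in> topspace hilbert_cube. r i \<in> ball (q i) \<delta>}" for i
  proof (rule openin_continuous_map_preimage[of _ euclideanreal])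
    have "continuous_map hilbert_cube (top_of_set {0..1::real}) (\<lambda>r. r i)"
      unfolding hilbert_cube_def by (rule continuous_map_product_projection) simp
    then show "continuous_map hilbert_cube euclideanreal (\<lambda>r. r i)"
      by (rule continuous_map_into_fulltopology)
  qed simp
  then have "openin hilbert_cube (topspace hilbert_cube \<inter>
      \<Inter> ((\<lambda>i. {r \<in> topspace hilbert_cube. r i \<in> ball (q i) \<delta>}) ` {..<N}))"
    by (intro openin_Int_Inter) auto
  also have "topspace hilbert_cube \<inter>
      \<Inter> ((\<lambda>i. {r \<in> topspace hilbert_cube. r i \<in> ball (q i) \<delta>}) ` {..<N}) =
      {r \<in> topspace hilbert_cube. \<forall>i<N. \<bar>q i - r i\<bar> < \<delta>}"
    by (auto simp: dist_real_def)
  finally show ?thesis .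
qed

section \<open>The bunch formed by the interpolating spaces\<close>

context interpolation
begin

definition bunch :: "gh_space \<Rightarrow> gh_space \<Rightarrow> real \<times> (nat \<Rightarrow> real) \<Rightarrow> gh_space" where
  "bunch X Y = (\<lambda>(s, q). if s = 0 then X else if s = 1 then Y else gh_class (M s q))"

lemma bunch_branching:
  fixes mX mY :: "real metric"
  assumes X: "ne_compact mX" "X = gh_class mX" and Y: "ne_compact mY" "Y = gh_class mY"
    and f: "range f = mspace mX" "\<And>z z'. d z z' = mdist mX (f z) (f z')"
    and g: "range g = mspace mY" "\<And>z z'. e z z' = mdist mY (g z) (g z')"
    and D: "gh_dist X Y = D"
  shows "branching_bunch A X Y (bunch X Y)"
proof -
  let ?F = "bunch X Y" and ?Q = "UNIV \<rightarrow> {0..1} :: (nat \<Rightarrow> real) set"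
  \<comment> \<open>A uniform description of all values, ends included: the class of a space with a
    surjection from the binary sequences that pulls its metric back to \<open>\<rho> s q\<close>.
    The surjection need not be injective at the ends.\<close>
  have rep: "\<exists>(m :: real metric) \<pi>. ne_compact m \<and> ?F (s, q) = gh_class m \<and> range \<pi> = mspace m \<and>
      (\<forall>z z'. mdist m (\<pi> z) (\<pi> z') = \<rho> s q z z')" if s: "s \<in> {0..1}" and q: "q \<in> ?Q" for s q
  proof -
    have "s = 0 \<or> s = 1 \<or> s \<in> {0<..<1}" using s by auto
    then consider "s = 0" | "s = 1" | "s \<in> {0<..<1}" by blast
    then show ?thesis
    proof cases
      case 1
      then show ?thesis
        using X f \<rho>_0[OF q] by (intro exI[of _ mX] exI[of _ f]) (simp add: bunch_def)
    next
      case 2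
      then show ?thesis
        using Y g \<rho>_1[OF q] by (intro exI[of _ mY] exI[of _ g]) (simp add: bunch_def)
    next
      case 3
      have M: "ne_compact (M s q)" using M_cantor[OF 3 q] by blast
      obtain m :: "real metric" where m: "isometric (M s q) m" "ne_compact m"
        using gh_class_real[OF M] by blast
      then obtain \<pi> where \<pi>: "isometric_embedding (M s q) m \<pi>" "\<pi> ` mspace (M s q) = mspace m"
        unfolding isometric_def by blast
      have "gh_class (M s q) = gh_class m" using gh_class_eq_iff[OF M m(2)] m(1) by simp
      then show ?thesis
        using 3 m(2) \<pi> mspace_M[OF 3 q] mdist_M[OF 3 q]
        by (intro exI[of _ m] exI[of _ \<pi>]) (simp add: bunch_def isometric_embedding_def)
    qed
  qed
  have dist_le: "gh_dist (?F (s, q)) (?F (t, r)) \<le> K"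
    if sq: "s \<in> {0..1}" "q \<in> ?Q" and tr: "t \<in> {0..1}" "r \<in> ?Q"
      and K: "\<And>z z'. \<bar>\<rho> s q z z' - \<rho> t r z z'\<bar> \<le> 2 * K" for s q t r K
  proof -
    obtain m :: "real metric" and \<pi> where m: "ne_compact m" "?F (s, q) = gh_class m" "range \<pi> = mspace m"
      "\<And>z z'. mdist m (\<pi> z) (\<pi> z') = \<rho> s q z z'"
      using rep[OF sq] by blast
    obtain m' :: "real metric" and \<pi>' where m': "ne_compact m'" "?F (t, r) = gh_class m'"
      "range \<pi>' = mspace m'" "\<And>z z'. mdist m' (\<pi>' z) (\<pi>' z') = \<rho> t r z z'"
      using rep[OF tr] by blast
    have "gh_close m m' K"
    proof (rule gh_closeI[where S = UNIV and f = \<pi> and g = \<pi>'])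
      show "\<exists>z\<in>UNIV. \<pi> z = x" if "x \<in> mspace m" for x
        using that m(3) by (metis UNIV_I imageE)
      show "\<exists>z\<in>UNIV. \<pi>' z = x" if "x \<in> mspace m'" for x
        using that m'(3) by (metis UNIV_I imageE)
    qed (use m m' K in auto)
    then show ?thesis unfolding m(2) m'(2) by (rule gh_dist_class_le[OF m(1) m'(1)])
  qed
  have lip: "gh_dist (?F (s, q)) (?F (t, q)) \<le> D * \<bar>s - t\<bar>"
    if "s \<in> {0..1}" "t \<in> {0..1}" "q \<in> ?Q" for s t q
    using \<rho>_lipschitz[OF that(3)] by (intro dist_le that) (simp add: mult.assoc)
  have ends: "?F (0, q) = X" "?F (1, q) = Y" for q by (simp_all add: bunch_def)
  have dist_eq_le: "gh_dist (?F (s, q)) (?F (t, q)) = D * (t - s)"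
    if st: "s \<in> {0..1}" "t \<in> {0..1}" "s \<le> t" and q: "q \<in> ?Q" for s t q
  proof (rule antisym)
    show "gh_dist (?F (s, q)) (?F (t, q)) \<le> D * (t - s)"
      using lip[OF st(1,2) q] st(3) by simp
    \<comment> \<open>Reverse inequality: the three pieces add up to at least \<open>D\<close>, and
      the outer two are bounded by the Lipschitz estimate.\<close>
    have "D \<le> gh_dist X (?F (s, q)) + (gh_dist (?F (s, q)) (?F (t, q)) + gh_dist (?F (t, q)) Y)"
      using GH.triangle[of X "?F (s, q)" Y] GH.triangle[of "?F (s, q)" "?F (t, q)" Y] D by simp
    moreover have "gh_dist X (?F (s, q)) \<le> D * s"
      using lip[of 0 s q] st(1) q by (simp add: ends)
    moreover have "gh_dist (?F (t, q)) Y \<le> D * (1 - t)"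
      using lip[of t 1 q] st(2) q by (simp add: ends)
    ultimately show "D * (t - s) \<le> gh_dist (?F (s, q)) (?F (t, q))"
      by (simp add: right_diff_distrib)
  qed
  have dist_eq: "gh_dist (?F (s, q)) (?F (t, q)) = \<bar>s - t\<bar> * D"
    if "s \<in> {0..1}" "t \<in> {0..1}" "q \<in> ?Q" for s t q
  proof (cases "s \<le> t")
    case True
    then show ?thesis using dist_eq_le[OF that(1,2) True that(3)] by (simp add: mult.commute)
  next
    case False
    then show ?thesis
      using dist_eq_le[OF that(2,1) _ that(3)] GH.commute[of "?F (s, q)"] by (simp add: mult.commute)
  qed
  have cont: "continuous_map (prod_topology (top_of_set {0..1}) hilbert_cube) GH.mtopology ?F"
    unfolding GH.continuous_map_to_metric
  proof (intro ballI allI impI)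
    fix p :: "real \<times> (nat \<Rightarrow> real)" and \<eta> :: real
    assume p: "p \<in> topspace (prod_topology (top_of_set {0..1}) hilbert_cube)"
      and \<eta>: "0 < \<eta>"
    obtain s q where sq: "p = (s, q)" "s \<in> {0..1}" "q \<in> topspace hilbert_cube" using p by auto
    then have q: "q \<in> ?Q" by (simp add: topspace_hilbert_cube)
    obtain N where N: "c N < \<eta>"
      using eventually_happens'[OF sequentially_bot order_tendstoD(2)[OF c_lim \<eta>]] by blast
    \<comment> \<open>All coordinates recorded at levels up to \<open>N\<close> have index below
      \<open>n\<close>; beyond level \<open>N\<close> the bound \<open>c N < \<eta>\<close>
      suffices.\<close>
    define n where "n = Suc (Max ((\<lambda>k. fst (prod_decode k)) ` {..N}))"
    have n: "fst (prod_decode k) < n" if "k \<le> N" for k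
      unfolding n_def less_Suc_eq_le using that by (intro Max_ge) auto
    \<comment> \<open>The radius for \<open>s\<close> moves the value by less than
      \<open>\<eta> / 2\<close>. The radius for the coordinates compensates the factor
      \<open>c k \<le> D\<close>, so \<open>\<rho>\<close> changes by at most \<open>\<eta>\<close>
      and the class by at most \<open>\<eta> / 2\<close>.\<close>
    let ?U = "({0..1} \<inter> ball s (\<eta> / (2 * D))) \<times> {r \<in> topspace hilbert_cube. \<forall>i<n. \<bar>q i - r i\<bar> < \<eta> / D}"
    have "openin (prod_topology (top_of_set {0..1}) hilbert_cube) ?U"
      using openin_hilbert_cube_cylinder[OF sq(3)] openin_open_Int[of "ball s (\<eta> / (2 * D))" "{0..1}"]
      by (simp add: openin_prod_Times_iff)
    moreover have "p \<in> ?U" using sq \<eta> D_pos by simp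
    moreover have "?F y \<in> GH.mball (?F p) \<eta>" if y: "y \<in> ?U" for y
    proof -
      obtain t r where tr: "y = (t, r)" "t \<in> {0..1}" "\<bar>s - t\<bar> < \<eta> / (2 * D)" "r \<in> topspace hilbert_cube"
        "\<And>i. i < n \<Longrightarrow> \<bar>q i - r i\<bar> < \<eta> / D"
        using y by (auto simp: dist_real_def)
      then have r: "r \<in> ?Q" by (simp add: topspace_hilbert_cube)
      have "\<bar>w k t q - w k t r\<bar> \<le> \<eta>" for k
      proof (cases "k \<le> N")
        case True
        have "c k * \<bar>q (fst (prod_decode k)) - r (fst (prod_decode k))\<bar> \<le> D * (\<eta> / D)"
          using tr(5)[OF n[OF True]] c_le_D[of k] c_pos[of k] D_pos by (intro mult_mono) auto
        then show ?thesis using w_diff[OF tr(2), of k q r] D_pos by simp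
      next
        case False
        have "q (fst (prod_decode k)) \<in> {0..1}" "r (fst (prod_decode k)) \<in> {0..1}"
          using q r by blast+
        then have "c k * \<bar>q (fst (prod_decode k)) - r (fst (prod_decode k))\<bar> \<le> c N * 1"
          using c_antimono[of N k] False c_pos[of k] c_pos[of N] by (intro mult_mono) auto
        then show ?thesis using w_diff[OF tr(2), of k q r] N by linarith
      qed
      then have "\<bar>\<rho> t q z z' - \<rho> t r z z'\<bar> \<le> 2 * (\<eta> / 2)" for z z'
        using \<rho>_diff[of t q r \<eta>] by simp
      then have "gh_dist (?F (t, q)) (?F (t, r)) \<le> \<eta> / 2"
        by (rule dist_le[OF tr(2) q tr(2) r])
      moreover have "gh_dist (?F (s, q)) (?F (t, q)) < \<eta> / 2"
        using dist_eq[OF sq(2) tr(2) q] tr(3) D_pos by (simp add: field_simps)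
      ultimately show ?thesis
        using GH.triangle[of "?F (s, q)" "?F (t, q)" "?F (t, r)"] by (simp add: sq(1) tr(1))
    qed
    ultimately show "\<exists>U. openin (prod_topology (top_of_set {0..1}) hilbert_cube) U \<and> p \<in> U \<and>
        (\<forall>y\<in>U. ?F y \<in> GH.mball (?F p) \<eta>)"
      by blast
  qed
  have geod: "geodesic UNIV gh_dist (\<lambda>s. ?F (s, q)) X Y" if q: "q \<in> topspace hilbert_cube" for q
    unfolding geodesic_def
  proof (intro conjI ballI)
    have "continuous_map (top_of_set {0..1}) (prod_topology (top_of_set {0..1}) hilbert_cube) (\<lambda>s::real. (s, q))"
      using q by (intro continuous_map_pairedI) auto
    from continuous_map_compose[OF this cont]
    show "continuous_map (top_of_set {0..1}) GH.mtopology (\<lambda>s. ?F (s, q))" by (simp add: comp_def)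
    show "gh_dist (?F (s, q)) (?F (t, q)) = \<bar>s - t\<bar> * gh_dist X Y" if "s \<in> {0..1}" "t \<in> {0..1}" for s t
      using dist_eq[OF that] q by (simp add: D topspace_hilbert_cube)
  qed (rule ends)+
  have inj: "(s, q) = (t, r)"
    if s: "s \<in> {0..1} - A" and t: "t \<in> {0..1} - A" and q: "q \<in> ?Q" and r: "r \<in> ?Q"
      and eq: "?F (s, q) = ?F (t, r)" for s t q r
  proof -
    have "s \<noteq> 0" "s \<noteq> 1" "t \<noteq> 0" "t \<noteq> 1" using s t A(3) by auto
    then have s': "s \<in> {0<..<1} - A" using s by auto
    \<comment> \<open>The distance from \<open>X\<close> is \<open>D * s\<close>, so equal values
      occur at equal times whatever the parameters.\<close>
    have "D * s = D * t"
      using dist_eq_le[of 0 s q] dist_eq_le[of 0 t r] s t q r eq by (auto simp: ends)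
    then have "s = t" using D_pos by simp
    then have "gh_class (M s q) = gh_class (M s r)"
      using eq \<open>s \<noteq> 0\<close> \<open>s \<noteq> 1\<close> by (simp add: bunch_def)
    then have "isometric (M s q) (M s r)"
      using gh_class_eq_iff M_cantor s' q r by blast
    then show ?thesis using isometric_M_imp_eq[OF s' q r] \<open>s = t\<close> by simp
  qed
  show ?thesis
    unfolding branching_bunch_def
  proof (intro conjI)
    show "\<forall>s\<in>A. \<forall>q\<in>topspace hilbert_cube. \<forall>r\<in>topspace hilbert_cube. ?F (s, q) = ?F (s, r)"
      using M_cong by (auto simp: bunch_def) metis
    show "\<forall>(s, q)\<in>({0..1} - A) \<times> topspace hilbert_cube.
        \<forall>(t, r)\<in>({0..1} - A) \<times> topspace hilbert_cube. (s, q) \<noteq> (t, r) \<longrightarrow> ?F (s, q) \<noteq> ?F (t, r)"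
      using inj unfolding topspace_hilbert_cube by blast
  qed (use cont geod ends in auto)
qed

lemma bunch_in_CA:
  assumes "X \<in> CA" "Y \<in> CA"
  shows "bunch X Y ` ({0..1} \<times> topspace hilbert_cube) \<subseteq> CA"
proof (rule image_subsetI)
  fix p :: "real \<times> (nat \<Rightarrow> real)" assume "p \<in> {0..1} \<times> topspace hilbert_cube"
  then obtain s q where p: "p = (s, q)" "s \<in> {0..1}" "q \<in> UNIV \<rightarrow> {0..1}"
    by (auto simp: topspace_hilbert_cube)
  have "s = 0 \<or> s = 1 \<or> s \<in> {0<..<1}" using p(2) by auto
  then consider "s = 0" | "s = 1" | "s \<in> {0<..<1}" by blast
  then show "bunch X Y p \<in> CA"
  proof cases
    case 3
    then have "gh_class (M s q) \<in> CA" using M_cantor[OF 3 p(3)] gh_class_in_CA_iff by blast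
    then show ?thesis using 3 p(1) by (simp add: bunch_def)
  qed (use assms p(1) in \<open>auto simp: bunch_def\<close>)
qed

end

theorem theorem1p5:
  fixes X Y :: gh_space and A :: "real set"
  assumes "X \<in> CA" "Y \<in> CA"
    and "closed A" "A \<subseteq> {0..1}" "{0, 1} \<subseteq> A"
    and "X \<noteq> Y \<or> A = {0..1}"
  shows "\<exists>F. branching_bunch A X Y F \<and> F ` ({0..1} \<times> topspace hilbert_cube) \<subseteq> CA"
proof (cases "X = Y")
  case True
  then show ?thesis
    using assms branching_bunch_const[OF assms(1)] by (intro exI[of _ "\<lambda>_. X"]) auto
next
  case False
  define D where "D = gh_dist X Y"
  have D: "0 < D" using False GH.mdist_pos_eq[of X Y] by (simp add: D_def)
  obtain mX :: "real metric" where mX: "ne_compact mX" "X = gh_class mX" using gh_class_surj by metis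
  obtain mY :: "real metric" where mY: "ne_compact mY" "Y = gh_class mY" using gh_class_surj by metis
  have cX: "cantor_metric_space mX" using gh_class_in_CA_iff[OF mX(1)] mX(2) assms(1) by simp
  have cY: "cantor_metric_space mY" using gh_class_in_CA_iff[OF mY(1)] mY(2) assms(2) by simp
  obtain h where h: "coupling_within mX mY D h"
    using gh_dist_class_coupling[OF mX(1) mY(1)] mX mY by (auto simp: D_def)
  then have hc: "coupling mX mY h" by (simp add: coupling_within_def)
  have "mspace mX \<noteq> {}" using mX(1) by (simp add: ne_compact_def)
  then obtain f g where f: "range f = mspace mX" and g: "range g = mspace mY"
    and fg: "\<And>z. h (f z) (g z) \<le> D"
    and uf: "\<And>r. 0 < r \<Longrightarrow> \<exists>n. \<forall>z z'. agree n z z' \<longrightarrow> mdist mX (f z) (f z') < r"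
    and ug: "\<And>r. 0 < r \<Longrightarrow> \<exists>n. \<forall>z z'. agree n z z' \<longrightarrow> mdist mY (g z) (g z') < r"
    using coupling_param[OF cX _ cY h] by metis
  have fX: "f z \<in> mspace mX" and gY: "g z \<in> mspace mY" for z using f g by blast+
  obtain K L where K: "\<And>x y. x \<in> mspace mX \<Longrightarrow> y \<in> mspace mX \<Longrightarrow> mdist mX x y \<le> K"
    and L: "\<And>x y. x \<in> mspace mY \<Longrightarrow> y \<in> mspace mY \<Longrightarrow> mdist mY x y \<le> L"
    using mX(1) mY(1) mdist_le_of_ne_compact by metis
  \<comment> \<open>One function controls both pulled-back metrics, so a single modulus
    \<open>\<epsilon>\<close> serves for both.\<close>
  let ?m = "\<lambda>z z'. max (mdist mX (f z) (f z')) (mdist mY (g z) (g z'))"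
  have unif: "\<exists>n. \<forall>z z'. agree n z z' \<longrightarrow> ?m z z' < r" if r: "0 < r" for r
  proof -
    obtain n m where "\<And>z z'. agree n z z' \<Longrightarrow> mdist mX (f z) (f z') < r"
      "\<And>z z'. agree m z z' \<Longrightarrow> mdist mY (g z) (g z') < r"
      using uf[OF r] ug[OF r] by blast
    then have "?m z z' < r" if "agree (max n m) z z'" for z z'
      using agree_mono[OF that max.cobounded1] agree_mono[OF that max.cobounded2] by simp
    then show ?thesis by blast
  qed
  obtain \<epsilon> where \<epsilon>: "\<And>k. 0 \<le> \<epsilon> k" "\<And>k. \<epsilon> (Suc k) \<le> \<epsilon> k" "\<epsilon> \<longlonglongrightarrow> 0"
    "\<And>k z z'. agree k z z' \<Longrightarrow> ?m z z' \<le> \<epsilon> k"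
  proof (rule agree_modulus[of ?m "max K L"])
    show "0 \<le> ?m z z'" for z z' by (simp add: le_max_iff_disj)
    show "?m z z' \<le> max K L" for z z' using K[OF fX fX] L[OF gY gY] by (meson max.mono)
  qed (use unif that in blast)+
  obtain c where c: "\<And>k. 0 < c k" "\<And>k. c (Suc k) < c k" "c 0 \<le> D" "c \<longlonglongrightarrow> 0"
    "\<And>t. 0 < t \<Longrightarrow> \<forall>\<^sub>F k in sequentially. \<epsilon> k \<le> t * c (Suc k)"
    using dominating_null_sequence[OF \<epsilon>(1-3) D] by blast
  \<comment> \<open>A segment in one space is compared with that of the partners by crossing the
    coupling twice, at a cost of at most \<open>D\<close> each time.\<close>
  have dist: "\<bar>mdist mX (f z) (f z') - mdist mY (g z) (g z')\<bar> \<le> 2 * D" for z z'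
    using couplingD(3)[OF hc fX[of z] fX[of z'] gY[of z']]
      couplingD(4)[OF hc fX[of z] gY[of z] gY[of z']]
      couplingD(5)[OF hc fX[of z'] gY[of z'] gY[of z]]
      couplingD(2)[OF hc fX[of z'] fX[of z] gY[of z]]
      fg[of z] fg[of z'] mdist_commute[of mX "f z" "f z'"] mdist_commute[of mY "g z" "g z'"]
    by linarith
  interpret I: interpolation "\<lambda>z z'. mdist mX (f z) (f z')" "\<lambda>z z'. mdist mY (g z) (g z')" D c \<epsilon> A
  proof
    show "mdist mX (f z) (f z') \<le> \<epsilon> k" "mdist mY (g z) (g z') \<le> \<epsilon> k" if "agree k z z'" for k z z'
      using \<epsilon>(4)[OF that] by simp_all
  qed (use fX gY dist \<epsilon>(3) c assms in \<open>auto intro: mdist_triangle mdist_commute\<close>)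
  have "branching_bunch A X Y (I.bunch X Y)"
    by (rule I.bunch_branching[OF mX mY f _ g]) (simp_all add: D_def)
  then show ?thesis using I.bunch_in_CA[OF assms(1,2)] by blast
qed

end
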